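(* There is a constant $c_0>0$ such that for all $V>0$, $$c_0\min\{V,\,V^{2/3}\}\le F_\ell(V)\le\frac{1}{c_0}\min\{V,\,V^{2/3}\}.$$ Further, there is a constant $c>0$ with the following property: if $V$ is large enough and $(u,h)\in\mathcal{A}^\ell_V$ satisfies $\int_{\Omega_h}|\nabla u|^2\,dx\,dy+\int_{\mathbb{R}}|h'|\le\frac{1}{c_0}\min\{V,\,V^{2/3}\}$, then $\sup h\ge cV^{2/3}$.
   Context: For $h:\mathbb{R}\to[0,\infty)$ lower semicontinuous, let $\Omega_h:=\{(x,y)\in\mathbb{R}^2:0<y<h(x)\}$ and let $\int_{\mathbb{R}}|h'|$ denote the pointwise variation $\sup\{\sum_{i}|h(x_i)-h(x_{i-1})|: x_1<\dots<x_n\}$. For $V>0$, let $\mathcal{A}^\ell_V$ be the set of pairs $(u,h)$ with $h\in BV(\mathbb{R})$ lower semicontinuous, $h\ge0$, $u\in H^1(\Omega_h)$ real-valued, $\int_{\mathbb{R}}h\,dx=V$, and $u(x,0)=x$ (in the sense of traces) for $x\in\operatorname{supp}h$. Set $$F_\ell(V):=\inf\left\{\int_{\Omega_h}|\nabla u|^2\,dx\,dy+\int_{\mathbb{R}}|h'| : (u,h)\in\mathcal{A}^\ell_V\right\}.$$ *)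

theory Defs
  imports "HOL-Analysis.Analysis"
begin

section \<open>Smooth functions and test functions\<close>

primrec Ck :: "nat \<Rightarrow> ('a::euclidean_space \<Rightarrow> real) \<Rightarrow> bool" where
  "Ck 0 f \<longleftrightarrow> continuous_on UNIV f"
| "Ck (Suc k) f \<longleftrightarrow>
     (\<forall>x. f differentiable (at x)) \<and> (\<forall>v. Ck k (\<lambda>x. frechet_derivative f (at x) v))"

definition smooth :: "('a::euclidean_space \<Rightarrow> real) \<Rightarrow> bool" where
  "smooth f \<longleftrightarrow> (\<forall>k. Ck k f)"

definition gradient :: "('a::euclidean_space \<Rightarrow> real) \<Rightarrow> 'a \<Rightarrow> 'a" where
  "gradient f x = (\<Sum>i\<in>Basis. frechet_derivative f (at x) i *\<^sub>R i)"

definition test_functions :: "'a::euclidean_space set \<Rightarrow> ('a \<Rightarrow> real) set" where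
  "test_functions \<Omega> = {\<phi>. smooth \<phi> \<and> (\<exists>K. compact K \<and> K \<subseteq> \<Omega> \<and> (\<forall>x. x \<notin> K \<longrightarrow> \<phi> x = 0))}"


section \<open>The Sobolev space of square-integrable functions with square-integrable weak gradient\<close>

definition L2 :: "'a::euclidean_space set \<Rightarrow> ('a \<Rightarrow> 'b::euclidean_space) set" where
  "L2 \<Omega> = {f. f \<in> borel_measurable (lebesgue_on \<Omega>) \<and>
              (\<integral>\<^sup>+x\<in>\<Omega>. ennreal ((norm (f x))\<^sup>2) \<partial>lebesgue) < \<infinity>}"

text \<open>For \<open>u\<close> and \<open>G\<close> in \<open>L2\<close>, both integrands below are integrable, so the identity is the
  genuine integration by parts formula.\<close>

definition is_weak_gradient ::
  "'a::euclidean_space set \<Rightarrow> ('a \<Rightarrow> real) \<Rightarrow> ('a \<Rightarrow> 'a) \<Rightarrow> bool" where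
  "is_weak_gradient \<Omega> u G \<longleftrightarrow>
     (\<forall>\<phi>\<in>test_functions \<Omega>.
        (LINT x:\<Omega>|lebesgue. u x *\<^sub>R gradient \<phi> x) = - (LINT x:\<Omega>|lebesgue. \<phi> x *\<^sub>R G x))"

definition H1 :: "'a::euclidean_space set \<Rightarrow> ('a \<Rightarrow> real) set" where
  "H1 \<Omega> = {u. u \<in> L2 \<Omega> \<and> (\<exists>G\<in>L2 \<Omega>. is_weak_gradient \<Omega> u G)}"

text \<open>For open \<open>\<Omega>\<close> and \<open>u\<close> in \<open>H1 \<Omega>\<close> the weak gradient is unique up to null sets of \<open>\<Omega>\<close>,
  so it is only used under an integral over subsets of \<open>\<Omega>\<close>.\<close>

definition weak_gradient ::
  "'a::euclidean_space set \<Rightarrow> ('a \<Rightarrow> real) \<Rightarrow> 'a \<Rightarrow> 'a" where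
  "weak_gradient \<Omega> u = (SOME G. G \<in> L2 \<Omega> \<and> is_weak_gradient \<Omega> u G)"


section \<open>Traces on the bottom boundary\<close>

text \<open>The trace of a Sobolev function is the continuous extension of the restriction of functions
  smooth up to the boundary. For every open rectangle \<open>R = ]a,b[ \<times> ]0,t[\<close> inside \<open>\<Omega>\<close>, the
  function \<open>T\<close> is required on \<open>]a,b[\<close> to be the \<open>L\<^sup>2\<close> limit of the boundary values of functions that
  are smooth up to the closure of \<open>R\<close> and converge to \<open>u\<close> in the Sobolev norm of \<open>R\<close> (the weak
  gradient of \<open>u\<close> in \<open>R\<close> being the restriction of the one in \<open>\<Omega>\<close>). For
  \<open>\<Omega> = subgraph h\<close> with \<open>h\<close> lower semicontinuous, these
  intervals cover the open set \<open>h > 0\<close>, so \<open>T\<close> is determined almost everywhere there; no condition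
  is imposed on \<open>T\<close> outside this set.\<close>

definition is_bottom_trace ::
  "(real \<times> real) set \<Rightarrow> (real \<times> real \<Rightarrow> real) \<Rightarrow> (real \<Rightarrow> real) \<Rightarrow> bool" where
  "is_bottom_trace \<Omega> u T \<longleftrightarrow>
     T \<in> borel_measurable lebesgue \<and>
     (\<forall>a b t. a < b \<and> 0 < t \<and> {a<..<b} \<times> {0<..<t} \<subseteq> \<Omega> \<longrightarrow>
        (\<exists>v :: nat \<Rightarrow> real \<times> real \<Rightarrow> real.
           (\<forall>n. smooth (v n)) \<and>
           (\<lambda>n. \<integral>\<^sup>+p\<in>{a<..<b} \<times> {0<..<t}.
                  ennreal ((v n p - u p)\<^sup>2 + (norm (gradient (v n) p - weak_gradient \<Omega> u p))\<^sup>2)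
                  \<partial>lebesgue) \<longlonglongrightarrow> 0 \<and>
           (\<lambda>n. \<integral>\<^sup>+x\<in>{a<..<b}. ennreal ((v n (x, 0) - T x)\<^sup>2) \<partial>lebesgue) \<longlonglongrightarrow> 0))"


section \<open>Profiles\<close>

definition lower_semicontinuous :: "(real \<Rightarrow> real) \<Rightarrow> bool" where
  "lower_semicontinuous h \<longleftrightarrow> (\<forall>x. \<forall>a<h x. \<forall>\<^sub>F y in nhds x. a < h y)"

text \<open>Integrable functions whose distributional derivative is a finite measure. This does not force
  the pointwise variation of the given representative to be finite.\<close>

definition BV :: "(real \<Rightarrow> real) set" where
  "BV = {h. integrable lebesgue h \<and>
            bdd_above {LINT x|lebesgue. h x * deriv \<phi> x | \<phi>.
                         \<phi> \<in> test_functions UNIV \<and> (\<forall>x. \<bar>\<phi> x\<bar> \<le> 1)}}"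

definition pointwise_variation :: "(real \<Rightarrow> real) \<Rightarrow> ennreal" where
  "pointwise_variation h =
     (SUP (n, x) \<in> {(n::nat, x::nat \<Rightarrow> real). strict_mono_on {..n} x}.
        ennreal (\<Sum>i=1..n. \<bar>h (x i) - h (x (i - 1))\<bar>))"

definition subgraph :: "(real \<Rightarrow> real) \<Rightarrow> (real \<times> real) set" where
  "subgraph h = {(x, y). 0 < y \<and> y < h x}"


section \<open>The variational problem\<close>

definition admissible :: "real \<Rightarrow> ((real \<times> real \<Rightarrow> real) \<times> (real \<Rightarrow> real)) set" where
  "admissible V = {(u, h).
     h \<in> BV \<and> lower_semicontinuous h \<and> (\<forall>x. 0 \<le> h x) \<and>
     u \<in> H1 (subgraph h) \<and>
     (LINT x|lebesgue. h x) = V \<and>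
     (\<exists>T. is_bottom_trace (subgraph h) u T \<and>
          (AE x in lebesgue. x \<in> closure {x. h x \<noteq> 0} \<longrightarrow> T x = x))}"

definition energy :: "(real \<times> real \<Rightarrow> real) \<Rightarrow> (real \<Rightarrow> real) \<Rightarrow> ennreal" where
  "energy u h =
     (\<integral>\<^sup>+p\<in>subgraph h. ennreal ((norm (weak_gradient (subgraph h) u p))\<^sup>2) \<partial>lebesgue)
     + pointwise_variation h"

definition F_ell :: "real \<Rightarrow> ennreal" where
  "F_ell V = (INF (u, h) \<in> admissible V. energy u h)"

end

theory Submission
  imports Defs
begin

text \<open>
  Both bounds rest on one observation: over a bottom interval of length \<open>l\<close> on which \<open>h \<ge> t\<close>, with
  \<open>t \<le> l\<close>, the prescribed unit strain at the bottom costs elastic energy of order \<open>l * t\<close>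
  (\<open>rectangle_energy_bound\<close>). This is seen by duality. For a function \<open>\<psi>\<close> that vanishes on the two
  sides and on the top of the rectangle, the rotated gradient of \<open>\<psi>\<close> is divergence free and tangential
  there, so pairing it with \<open>\<nabla>u\<close> leaves only the bottom term, which the trace \<open>u(x,0) = x\<close> turns into
  \<open>- \<integral> \<psi>(x,0) dx\<close>. A bump of width \<open>l\<close> and height \<open>t\<close>, quadratic in \<open>x\<close> and linear in \<open>y\<close>,
  then gives the bound. Only
  functions smooth up to the boundary are ever integrated by parts, and these are exactly the ones
  that define the trace.

  For the lower bound the line is cut into cells of length \<open>s\<close>. In a cell, \<open>h\<close> lies between its infimum
  \<open>m\<close> and \<open>m\<close> plus its variation there, so the excess over the infima contributes at most
  \<open>s * \<integral>|h'|\<close> to the volume. The rectangle over a cell of height \<open>min m s\<close> lies in the subgraph, and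
  the contributions \<open>s * m\<close> are at most \<open>1 + M/s\<close> times a multiple of its elastic energy, where \<open>M\<close> bounds \<open>h\<close>.
  Adding up (\<open>volume_bound\<close>), with \<open>E\<close> the energy,
    \<open>V \<le> s * E + 576 * (1 + M/s) * E\<close>   for every \<open>s > 0\<close>.
  An integrable profile is bounded by its variation, hence \<open>M = E\<close> is allowed, and \<open>s = \<surd>E\<close> gives
  \<open>V \<le> 577 * E powr (3/2) + 576 * E\<close>, the lower bound. If instead \<open>E\<close> is of order \<open>V powr (2/3)\<close>, then
  a small multiple of \<open>V powr (1/3)\<close> for \<open>s\<close> makes the first term at most \<open>V/2\<close>, and for large \<open>V\<close> the rest
  forces \<open>M\<close> to be of order \<open>V powr (2/3)\<close>.

  For the upper bound take a rectangular island of width \<open>L = max 1 (V powr (1/3))\<close> and height \<open>V/L\<close>, with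
  \<open>u(x,y) = x * exp (- y/L)\<close>: the strain decays over a height comparable to the width. As the
  weak gradient in the energy is an arbitrary choice among the weak gradients, the energy of this
  competitor can be computed only once weak gradients are known to be unique almost everywhere
  (\<open>weak_gradient_smooth_box\<close>), for which smooth bump functions are constructed.
\<close>


section \<open>Partial derivatives of smooth functions and the divergence theorem on a rectangle\<close>

lemma smooth_has_derivative:
  assumes "smooth f"
  shows "(f has_derivative frechet_derivative f (at x)) (at x)"
proof -
  have "Ck (Suc 0) f" using assms unfolding smooth_def by blast
  then show ?thesis by (simp add: frechet_derivative_works)
qed

lemma smooth_continuous_partial:
  assumes "smooth f"
  shows "continuous_on S (\<lambda>x. frechet_derivative f (at x) v)"
proof -
  have "Ck (Suc 0) f" using assms unfolding smooth_def by blast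
  then have "continuous_on UNIV (\<lambda>x. frechet_derivative f (at x) v)" by simp
  then show ?thesis using continuous_on_subset by blast
qed

lemma smooth_continuous:
  assumes "smooth f" shows "continuous_on S f"
  using assms continuous_on_subset unfolding smooth_def by (metis Ck.simps(1) subset_UNIV)

lemma gradient_pair:
  fixes f :: "real \<times> real \<Rightarrow> real"
  shows "gradient f p = (frechet_derivative f (at p) (1,0), frechet_derivative f (at p) (0,1))"
  unfolding gradient_def Basis_prod_def
  by (subst sum.union_disjoint) auto

lemma smooth_continuous_gradient:
  fixes f :: "real \<times> real \<Rightarrow> real"
  assumes "smooth f" shows "continuous_on S (gradient f)"
  unfolding gradient_pair[abs_def] by (intro continuous_intros smooth_continuous_partial assms)

lemma smooth_partial_fst:
  fixes f :: "real \<times> real \<Rightarrow> real"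
  assumes "smooth f"
  shows "((\<lambda>x. f (x, y)) has_real_derivative fst (gradient f (x, y))) (at x)"
proof -
  have "((\<lambda>x. f (x, y)) has_derivative (\<lambda>h. frechet_derivative f (at (x, y)) (h, 0))) (at x)"
    using has_derivative_compose[of "\<lambda>x. (x, y)" "\<lambda>h. (h, 0)" x UNIV f,
      OF has_derivative_Pair[OF has_derivative_ident has_derivative_const] smooth_has_derivative[OF assms]]
    by simp
  moreover have "frechet_derivative f (at (x, y)) (h, 0) = fst (gradient f (x, y)) * h" for h
    using linear_scale[OF has_derivative_linear[OF smooth_has_derivative[OF assms, of "(x,y)"]], of h "(1,0)"]
    by (simp add: gradient_pair)
  ultimately show ?thesis by (simp add: has_field_derivative_def)
qed

lemma smooth_partial_snd:
  fixes f :: "real \<times> real \<Rightarrow> real"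
  assumes "smooth f"
  shows "((\<lambda>y. f (x, y)) has_real_derivative snd (gradient f (x, y))) (at y)"
proof -
  have "((\<lambda>y. f (x, y)) has_derivative (\<lambda>h. frechet_derivative f (at (x, y)) (0, h))) (at y)"
    using has_derivative_compose[of "\<lambda>y. (x, y)" "\<lambda>h. (0, h)" y UNIV f,
      OF has_derivative_Pair[OF has_derivative_const has_derivative_ident] smooth_has_derivative[OF assms]]
    by simp
  moreover have "frechet_derivative f (at (x, y)) (0, h) = snd (gradient f (x, y)) * h" for h
    using linear_scale[OF has_derivative_linear[OF smooth_has_derivative[OF assms, of "(x,y)"]], of h "(0,1)"]
    by (simp add: gradient_pair)
  ultimately show ?thesis by (simp add: has_field_derivative_def)
qed

lemma integral_rectangle_partial_fst:
  fixes w g :: "real \<times> real \<Rightarrow> real"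
  assumes "a \<le> b" and cont: "continuous_on (cbox (a,c) (b,d)) g"
    and der: "\<And>x y. ((\<lambda>x. w (x,y)) has_real_derivative g (x,y)) (at x)"
  shows "integral (cbox (a,c) (b,d)) g = integral {c..d} (\<lambda>y. w (b,y) - w (a,y))"
proof -
  have "integral (cbox (a,c) (b,d)) g = integral (cbox a b) (\<lambda>x. integral (cbox c d) (\<lambda>y. g (x,y)))"
    by (rule integral_prod_continuous[OF cont])
  also have "\<dots> = integral (cbox c d) (\<lambda>y. integral (cbox a b) (\<lambda>x. g (x,y)))"
    by (rule integral_swap_continuous) (simp add: cont)
  also have "\<dots> = integral {c..d} (\<lambda>y. w (b,y) - w (a,y))"
  proof -
    have "integral {a..b} (\<lambda>x. g (x,y)) = w (b,y) - w (a,y)" for y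
      using assms(1) der
      by (intro integral_unique fundamental_theorem_of_calculus)
        (auto simp: has_real_derivative_iff_has_vector_derivative[symmetric] intro: has_field_derivative_at_within)
    then show ?thesis by simp
  qed
  finally show ?thesis .
qed

lemma integral_rectangle_partial_snd:
  fixes w g :: "real \<times> real \<Rightarrow> real"
  assumes "c \<le> d" and cont: "continuous_on (cbox (a,c) (b,d)) g"
    and der: "\<And>x y. ((\<lambda>y. w (x,y)) has_real_derivative g (x,y)) (at y)"
  shows "integral (cbox (a,c) (b,d)) g = integral {a..b} (\<lambda>x. w (x,d) - w (x,c))"
proof -
  have "integral (cbox (a,c) (b,d)) g = integral (cbox a b) (\<lambda>x. integral (cbox c d) (\<lambda>y. g (x,y)))"
    by (rule integral_prod_continuous[OF cont])
  also have "\<dots> = integral {a..b} (\<lambda>x. w (x,d) - w (x,c))"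
  proof -
    have "integral {c..d} (\<lambda>y. g (x,y)) = w (x,d) - w (x,c)" for x
      using assms(1) der
      by (intro integral_unique fundamental_theorem_of_calculus)
        (auto simp: has_real_derivative_iff_has_vector_derivative[symmetric] intro: has_field_derivative_at_within)
    then show ?thesis by simp
  qed
  finally show ?thesis .
qed

text \<open>The integrals that come from the divergence theorem are compared with the elastic energy, a
  nonnegative integral over the open rectangle.\<close>

lemma ennreal_integral_le_nn_integral:
  fixes f :: "'a::euclidean_space \<Rightarrow> real"
  assumes "continuous_on (cbox a b) f"
  shows "ennreal (integral (cbox a b) f) \<le> (\<integral>\<^sup>+x\<in>box a b. ennreal \<bar>f x\<bar> \<partial>lebesgue)"
proof -
  have ab: "set_integrable lebesgue (box a b) f"
    using absolutely_integrable_continuous[OF assms]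
    by (rule set_integrable_subset) (auto simp: box_subset_cbox)
  have "integral (cbox a b) f = (LINT x:box a b|lebesgue. f x)"
    using set_lebesgue_integral_eq_integral(2)[OF ab] integral_open_interval[of a b f] by simp
  then have "ennreal (integral (cbox a b) f) \<le> ennreal (norm (LINT x:box a b|lebesgue. f x))"
    by (simp add: ennreal_leI)
  also have "\<dots> \<le> (\<integral>\<^sup>+x. ennreal (norm (indicat_real (box a b) x *\<^sub>R f x)) \<partial>lebesgue)"
    using integral_norm_bound_ennreal[OF ab[unfolded set_integrable_def]]
    by (simp add: set_lebesgue_integral_def)
  also have "\<dots> = (\<integral>\<^sup>+x\<in>box a b. ennreal \<bar>f x\<bar> \<partial>lebesgue)"
    by (intro nn_integral_cong) (auto split: split_indicator)
  finally show ?thesis .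
qed

lemma box_pair:
  fixes a b c d :: real
  shows "box (a,c) (b,d) = {a<..<b} \<times> {c<..<d}"
  by (force simp: box_def Basis_prod_def)

lemma ennreal_add_le: "ennreal (x + y) \<le> ennreal x + ennreal y"
proof (cases "0 \<le> x \<and> 0 \<le> y")
  case False
  then have "x + y \<le> x \<or> x + y \<le> y" by linarith
  then show ?thesis
    by (metis add_increasing add_increasing2 ennreal_leI zero_le)
qed simp

section \<open>The elastic energy of a rectangle with unit strain on its bottom\<close>

text \<open>The rotated gradient \<open>(\<psi>\<^sub>y, - \<psi>\<^sub>x)\<close> of \<open>\<psi>(x,y) = (x - a) * (b - x) * (1 - y/t)\<close>, which vanishes on
  the sides and the top of the rectangle.\<close>

definition cutoff_field :: "real \<Rightarrow> real \<Rightarrow> real \<Rightarrow> real \<times> real \<Rightarrow> real \<times> real" where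
  "cutoff_field a b t = (\<lambda>(x, y). (- (x - a) * (b - x) / t, - (a + b - 2*x) * (1 - y/t)))"

lemma continuous_on_cutoff_field: "t \<noteq> 0 \<Longrightarrow> continuous_on S (cutoff_field a b t)"
  unfolding cutoff_field_def split_beta by (intro continuous_intros) auto

text \<open>The field is divergence free, and its normal component vanishes on the sides and on the top. Only
  first derivatives of \<open>v\<close> occur: in \<open>(v \<psi>\<^sub>y)\<^sub>x\<close> and \<open>(v \<psi>\<^sub>x)\<^sub>y\<close> the terms with the mixed derivative of \<open>\<psi>\<close> cancel.\<close>

lemma integral_gradient_cutoff_field:
  fixes v :: "real \<times> real \<Rightarrow> real"
  assumes v: "smooth v" and "a < b" "0 < t"
  shows "integral (cbox (a,0) (b,t)) (\<lambda>p. gradient v p \<bullet> cutoff_field a b t p)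
       = integral {a..b} (\<lambda>x. v (x,0) * (a + b - 2*x))"
proof -
  let ?R = "cbox (a,0) (b,t)"
  define g1 where "g1 = (\<lambda>p. fst (gradient v p) * (- (fst p - a) * (b - fst p) / t)
    + v p * (- (a + b - 2 * fst p) / t))"
  define g2 where "g2 = (\<lambda>p. snd (gradient v p) * ((a + b - 2 * fst p) * (1 - snd p / t))
    + v p * (- (a + b - 2 * fst p) / t))"
  have c1: "continuous_on ?R g1" and c2: "continuous_on ?R g2"
    unfolding g1_def g2_def using \<open>0 < t\<close>
    by (auto intro!: continuous_intros smooth_continuous[OF v] smooth_continuous_gradient[OF v])
  define w1 where "w1 = (\<lambda>(x,y). v (x,y) * (- (x - a) * (b - x) / t))"
  define w2 where "w2 = (\<lambda>(x,y). v (x,y) * ((a + b - 2 * x) * (1 - y/t)))"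
  have "((\<lambda>x. w1 (x,y)) has_real_derivative g1 (x,y)) (at x)" for x y
    using \<open>0 < t\<close> unfolding w1_def g1_def
    by (auto intro!: derivative_eq_intros smooth_partial_fst[OF v] simp: field_simps)
  then have "integral ?R g1 = integral {0..t} (\<lambda>y. w1 (b,y) - w1 (a,y))"
    using \<open>a < b\<close> c1 by (intro integral_rectangle_partial_fst) auto
  then have i1: "integral ?R g1 = 0" by (simp add: w1_def)
  have "((\<lambda>y. w2 (x,y)) has_real_derivative g2 (x,y)) (at y)" for x y
    using \<open>0 < t\<close> unfolding w2_def g2_def
    by (auto intro!: derivative_eq_intros smooth_partial_snd[OF v] simp: field_simps)
  then have "integral ?R g2 = integral {a..b} (\<lambda>x. w2 (x,t) - w2 (x,0))"
    using \<open>0 < t\<close> c2 by (intro integral_rectangle_partial_snd) auto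
  then have i2: "integral ?R g2 = - integral {a..b} (\<lambda>x. v (x,0) * (a + b - 2*x))"
    using \<open>0 < t\<close> by (simp add: w2_def)
  have "integral ?R (\<lambda>p. gradient v p \<bullet> cutoff_field a b t p) = integral ?R (\<lambda>p. g1 p - g2 p)"
    by (intro integral_cong) (auto simp: g1_def g2_def cutoff_field_def inner_prod_def split_beta algebra_simps)
  also have "\<dots> = integral ?R g1 - integral ?R g2"
    by (intro integral_diff integrable_continuous c1 c2)
  finally show ?thesis using i1 i2 by simp
qed


text \<open>In a rectangle at least as wide as high, the vertical slope of \<open>\<psi>\<close>, of order
  \<open>(b - a)\<^sup>2 / t\<close>, dominates the horizontal one.\<close>

lemma norm_cutoff_field_le:
  assumes "0 < t" "t \<le> b - a" "p \<in> box (a,0) (b,t)"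
  shows "norm (cutoff_field a b t p) \<le> 2 * (b - a)^2 / t"
proof -
  obtain x y where p: "p = (x,y)" "a < x" "x < b" "0 < y" "y < t"
    using assms(3) by (cases p) (auto simp: box_pair)
  define l where "l = b - a"
  have "\<bar>- (x - a) * (b - x) / t\<bar> \<le> l^2 / t"
  proof -
    have "(x - a) * (b - x) \<le> l * l"
      using p by (intro mult_mono) (auto simp: l_def)
    then have "(x - a) * (b - x) / t \<le> l^2 / t"
      using assms(1) by (simp add: divide_right_mono power2_eq_square)
    moreover have "0 \<le> (x - a) * (b - x) / t" using p assms(1) by simp
    moreover have "- (x - a) * (b - x) / t = - ((x - a) * (b - x) / t)"
      by (simp only: mult_minus_left minus_divide_left)
    ultimately show ?thesis by (metis abs_minus_cancel abs_of_nonneg)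
  qed
  moreover have "\<bar>- (a + b - 2*x) * (1 - y/t)\<bar> \<le> l^2 / t"
  proof -
    have "\<bar>a + b - 2*x\<bar> * \<bar>1 - y/t\<bar> \<le> l * 1"
      using p assms(1) by (intro mult_mono) (auto simp: l_def abs_if field_simps)
    then have "\<bar>a + b - 2*x\<bar> * \<bar>1 - y/t\<bar> \<le> l" by simp
    also have "l \<le> l^2 / t"
      using mult_left_mono[of t l l] assms by (simp add: l_def power2_eq_square pos_le_divide_eq)
    finally show ?thesis by (simp only: abs_mult abs_minus_cancel)
  qed
  moreover have "norm (cutoff_field a b t p) \<le> \<bar>- (x - a) * (b - x) / t\<bar> + \<bar>- (a + b - 2*x) * (1 - y/t)\<bar>"
    using norm_Pair_le[of "- (x - a) * (b - x) / t" "- (a + b - 2*x) * (1 - y/t)"]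
    by (simp add: p cutoff_field_def)
  ultimately show ?thesis by (simp add: l_def)
qed

lemma integral_moment:
  assumes "a \<le> (b::real)"
  shows "((\<lambda>x. x * (a + b - 2*x)) has_integral (- ((b - a)^3 / 6))) {a..b}"
proof -
  have "((\<lambda>x. x * (a + b - 2*x)) has_integral
      ((a + b) * b^2 / 2 - 2 * b^3/3) - ((a + b) * a^2 / 2 - 2 * a^3/3)) {a..b}"
    using assms
    by (intro fundamental_theorem_of_calculus)
      (auto simp: has_real_derivative_iff_has_vector_derivative[symmetric] power2_eq_square field_simps
        intro!: derivative_eq_intros)
  also have "((a + b) * b^2 / 2 - 2 * b^3/3) - ((a + b) * a^2 / 2 - 2 * a^3/3) = - ((b - a)^3 / 6)"
    by (simp add: field_simps power2_eq_square power3_eq_cube)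
  finally show ?thesis .
qed

text \<open>If \<open>v(x,0)\<close> were \<open>x\<close>, the pairing of \<open>\<nabla>v\<close> with the field would be \<open>- (b - a)^3 / 6\<close>. The first term on the
  right is the price for a bottom value different from \<open>x\<close>.\<close>

lemma smooth_rectangle_estimate:
  fixes v :: "real \<times> real \<Rightarrow> real"
  assumes v: "smooth v" and "a < b" "0 < t" "t \<le> b - a"
  shows "ennreal ((b - a)^3 / 6)
    \<le> (\<integral>\<^sup>+x\<in>box a b. ennreal ((b - a) * \<bar>v (x,0) - x\<bar>) \<partial>lebesgue)
      + (\<integral>\<^sup>+p\<in>box (a,0) (b,t). ennreal (2 * (b - a)^2 / t * norm (gradient v p)) \<partial>lebesgue)"
proof -
  let ?R = "cbox (a,0) (b,t)" and ?f = "\<lambda>p. - (gradient v p \<bullet> cutoff_field a b t p)"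
    and ?g = "\<lambda>x. (v (x,0) - x) * (a + b - 2*x)"
  have cv: "continuous_on S (\<lambda>x. v (x,0))" for S
    by (rule continuous_on_compose2[OF smooth_continuous[OF v, of UNIV]]) (auto intro!: continuous_intros)
  have "(b - a)^3 / 6 = - integral {a..b} (\<lambda>x. x * (a + b - 2*x))"
    using integral_moment[of a b] \<open>a < b\<close> by (simp add: integral_unique)
  also have "\<dots> = integral {a..b} ?g - integral {a..b} (\<lambda>x. v (x,0) * (a + b - 2*x))"
    by (subst integral_diff[symmetric])
      (auto intro!: integrable_continuous_interval continuous_intros cv simp: algebra_simps
         simp flip: integral_neg)
  also have "\<dots> = integral (cbox a b) ?g + integral ?R ?f"
    using integral_gradient_cutoff_field[OF v \<open>a < b\<close> \<open>0 < t\<close>] by simp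
  finally have "ennreal ((b - a)^3 / 6) \<le> ennreal (integral (cbox a b) ?g) + ennreal (integral ?R ?f)"
    by (simp only: ennreal_add_le)
  also have "\<dots> \<le> (\<integral>\<^sup>+x\<in>box a b. ennreal \<bar>?g x\<bar> \<partial>lebesgue) + (\<integral>\<^sup>+p\<in>box (a,0) (b,t). ennreal \<bar>?f p\<bar> \<partial>lebesgue)"
    using \<open>0 < t\<close>
    by (intro add_mono ennreal_integral_le_nn_integral)
      (auto intro!: continuous_intros cv smooth_continuous_gradient[OF v] continuous_on_cutoff_field)
  also have "\<dots> \<le> (\<integral>\<^sup>+x\<in>box a b. ennreal ((b - a) * \<bar>v (x,0) - x\<bar>) \<partial>lebesgue)
      + (\<integral>\<^sup>+p\<in>box (a,0) (b,t). ennreal (2 * (b - a)^2 / t * norm (gradient v p)) \<partial>lebesgue)"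
  proof (intro add_mono nn_integral_mono)
    fix x
    have "\<bar>?g x\<bar> \<le> (b - a) * \<bar>v (x,0) - x\<bar>" if "x \<in> box a b"
      unfolding abs_mult mult.commute[of "\<bar>v (x,0) - x\<bar>"] using that by (intro mult_right_mono) auto
    then show "ennreal \<bar>?g x\<bar> * indicator (box a b) x \<le> ennreal ((b - a) * \<bar>v (x,0) - x\<bar>) * indicator (box a b) x"
      by (auto split: split_indicator intro!: ennreal_leI)
  next
    fix p
    have "\<bar>?f p\<bar> \<le> 2 * (b - a)^2 / t * norm (gradient v p)" if "p \<in> box (a,0) (b,t)"
    proof -
      have "\<bar>?f p\<bar> \<le> norm (gradient v p) * norm (cutoff_field a b t p)"
        using Cauchy_Schwarz_ineq2 by simp
      also have "\<dots> \<le> norm (gradient v p) * (2 * (b - a)^2 / t)"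
        using norm_cutoff_field_le assms that by (intro mult_left_mono) auto
      finally show ?thesis by (simp add: mult.commute)
    qed
    then show "ennreal \<bar>?f p\<bar> * indicator (box (a,0) (b,t)) p
       \<le> ennreal (2 * (b - a)^2 / t * norm (gradient v p)) * indicator (box (a,0) (b,t)) p"
      by (auto split: split_indicator intro!: ennreal_leI)
  qed
  finally show ?thesis .
qed


lemma weak_gradient_in_L2:
  assumes "u \<in> H1 \<Omega>" shows "weak_gradient \<Omega> u \<in> L2 \<Omega>"
  using assms someI_ex[of "\<lambda>G. G \<in> L2 \<Omega> \<and> is_weak_gradient \<Omega> u G"]
  unfolding H1_def weak_gradient_def by blast

text \<open>The preceding estimate is applied to the functions that approximate \<open>u\<close> in the definition of the
  trace. Both of its terms are made quadratic by weighted inequalities of the form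
  \<open>a \<le> \<epsilon>/2 + a\<^sup>2/(2 * \<epsilon>)\<close>, with weights chosen such that each linear remainder is a quarter of the left-hand
  side \<open>l^3/6\<close>. This passes to the limit and leaves \<open>l^3/12 \<le> (48 * l\<^sup>2 / t) * E\<close>.\<close>

lemma rectangle_energy_bound:
  fixes u :: "real \<times> real \<Rightarrow> real"
  assumes u: "u \<in> H1 \<Omega>" and T: "is_bottom_trace \<Omega> u T"
    and Tx: "AE x in lebesgue. x \<in> {a<..<b} \<longrightarrow> T x = x"
    and "a < b" "0 < t" "t \<le> b - a" and sub: "{a<..<b} \<times> {0<..<t} \<subseteq> \<Omega>"
    and \<Omega>: "\<Omega> \<in> sets lebesgue"
  shows "ennreal ((b - a) * t / 576)
    \<le> (\<integral>\<^sup>+p\<in>{a<..<b} \<times> {0<..<t}. ennreal ((norm (weak_gradient \<Omega> u p))\<^sup>2) \<partial>lebesgue)"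
proof -
  let ?R = "{a<..<b} \<times> {0<..<t}" and ?I = "{a<..<b}"
  define l where "l = b - a"
  define G where "G = weak_gradient \<Omega> u"
  have l: "0 < l" "t \<le> l" using assms by (auto simp: l_def)
  obtain v where v: "\<And>n::nat. smooth (v n)"
    and D: "(\<lambda>n. \<integral>\<^sup>+p\<in>?R. ennreal ((v n p - u p)\<^sup>2 + (norm (gradient (v n) p - G p))\<^sup>2) \<partial>lebesgue) \<longlonglongrightarrow> 0"
    and d: "(\<lambda>n. \<integral>\<^sup>+x\<in>?I. ennreal ((v n (x, 0) - T x)\<^sup>2) \<partial>lebesgue) \<longlonglongrightarrow> 0"
    using T \<open>a < b\<close> \<open>0 < t\<close> sub unfolding is_bottom_trace_def G_def by meson
  have G: "G \<in> L2 \<Omega>" unfolding G_def by (rule weak_gradient_in_L2[OF u])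
  have R: "?R = box (a,0) (b,t)" by (simp add: box_pair)
  have Rs: "?R \<in> sets lebesgue" by (simp add: R)
  have meas: "f \<in> borel_measurable (lebesgue_on ?R)" if "f \<in> borel_measurable (lebesgue_on \<Omega>)" for f :: "real \<times> real \<Rightarrow> 'b::euclidean_space"
    using that sub Rs \<Omega> by (metis measurable_restrict_mono)
  have [measurable]: "u \<in> borel_measurable (lebesgue_on ?R)" "G \<in> borel_measurable (lebesgue_on ?R)"
    using u G by (auto simp: H1_def L2_def intro!: meas)
  have [measurable]: "v n \<in> borel_measurable (lebesgue_on ?R)" "gradient (v n) \<in> borel_measurable (lebesgue_on ?R)" for n
    using v Rs by (auto intro!: continuous_imp_measurable_on_sets_lebesgue smooth_continuous smooth_continuous_gradient)
  have cv: "continuous_on S (\<lambda>x. v n (x,0))" for S n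
    by (rule continuous_on_compose2[OF smooth_continuous[OF v, of UNIV]]) (auto intro!: continuous_intros)
  have [measurable]: "(\<lambda>x. v n (x,0)) \<in> borel_measurable lebesgue" for n
    using cv[of UNIV n] by (intro measurable_completion) (simp add: borel_measurable_continuous_onI)
  have [measurable]: "T \<in> borel_measurable lebesgue" "?I \<in> sets lebesgue"
    using T by (auto simp: is_bottom_trace_def)
  define E where "E = (\<integral>\<^sup>+p\<in>?R. ennreal ((norm (G p))\<^sup>2) \<partial>lebesgue)"
  define d where "d n = (\<integral>\<^sup>+x\<in>?I. ennreal ((v n (x, 0) - T x)\<^sup>2) \<partial>lebesgue)" for n
  define D where "D n = (\<integral>\<^sup>+p\<in>?R. ennreal ((v n p - u p)\<^sup>2 + (norm (gradient (v n) p - G p))\<^sup>2) \<partial>lebesgue)" for n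
  have bottom: "(\<integral>\<^sup>+x\<in>?I. ennreal (l * \<bar>v n (x,0) - x\<bar>) \<partial>lebesgue) \<le> ennreal (l^3/24) + 6 * d n" for n
  proof -
    have "(\<integral>\<^sup>+x\<in>?I. ennreal (l * \<bar>v n (x,0) - x\<bar>) \<partial>lebesgue)
      \<le> (\<integral>\<^sup>+x. ennreal (l^2/24) * indicator ?I x + 6 * (ennreal ((v n (x,0) - T x)\<^sup>2) * indicator ?I x) \<partial>lebesgue)"
    proof (rule nn_integral_mono_AE)
      show "AE x in lebesgue. ennreal (l * \<bar>v n (x,0) - x\<bar>) * indicator ?I x
        \<le> ennreal (l^2/24) * indicator ?I x + 6 * (ennreal ((v n (x,0) - T x)\<^sup>2) * indicator ?I x)"
        using Tx
      proof eventually_elim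
        case (elim x)
        \<comment> \<open>The weight is \<open>\<epsilon> = l/12\<close>.\<close>
        have "0 \<le> 6 * (\<bar>v n (x,0) - x\<bar> - l/12)\<^sup>2" by simp
        then have "l * \<bar>v n (x,0) - x\<bar> \<le> l^2/24 + 6 * (v n (x,0) - x)\<^sup>2"
          by (simp add: power2_diff power_divide)
        then have "ennreal (l * \<bar>v n (x,0) - x\<bar>) \<le> ennreal (l^2/24) + 6 * ennreal ((v n (x,0) - x)\<^sup>2)"
          using ennreal_leI by (fastforce simp: ennreal_plus ennreal_mult)
        then show ?case using elim by (auto split: split_indicator)
      qed
    qed
    also have "\<dots> = ennreal (l^2/24) * emeasure lebesgue ?I + 6 * d n"
      by (simp add: d_def nn_integral_add nn_integral_cmult)
    also have "ennreal (l^2/24) * emeasure lebesgue ?I = ennreal (l^3/24)"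
      using l \<open>a < b\<close> by (simp add: l_def power2_eq_square power3_eq_cube flip: ennreal_mult)
    finally show ?thesis .
  qed
  have bulk: "(\<integral>\<^sup>+p\<in>?R. ennreal (2 * l^2 / t * norm (gradient (v n) p)) \<partial>lebesgue)
     \<le> ennreal (l^3/24) + ennreal (48 * l^2 / t) * (D n + E)" for n
  proof -
    have eq: "(\<integral>\<^sup>+p\<in>?R. f p \<partial>lebesgue) = (\<integral>\<^sup>+p. f p \<partial>lebesgue_on ?R)" for f
      using Rs by (simp add: nn_integral_restrict_space)
    have "ennreal (2 * l^2 / t * norm (gradient (v n) p)) \<le> ennreal (l^2/(24*t))
      + ennreal (48 * l^2 / t) * (ennreal ((v n p - u p)\<^sup>2 + (norm (gradient (v n) p - G p))\<^sup>2) + ennreal ((norm (G p))\<^sup>2))" for p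
    proof -
      let ?g = "norm (gradient (v n) p)" and ?h = "norm (gradient (v n) p - G p)" and ?k = "norm (G p)"
      have "?g \<le> ?h + ?k" by (metis diff_add_cancel norm_triangle_ineq)
      then have "?g\<^sup>2 \<le> (?h + ?k)\<^sup>2" by (intro power_mono) auto
      also have "\<dots> \<le> 2 * ?h\<^sup>2 + 2 * ?k\<^sup>2"
        using sum_squares_bound[of ?h ?k] by (simp add: power2_sum)
      finally have *: "?g\<^sup>2 \<le> 2 * ?h\<^sup>2 + 2 * ?k\<^sup>2" .
      \<comment> \<open>The weight is \<open>\<epsilon> = 1/24\<close>, for \<open>a\<close> the norm of the gradient.\<close>
      have "0 \<le> 24 * (?g - 1/24)\<^sup>2" by simp
      then have "2 * ?g \<le> 1/24 + 24 * ?g\<^sup>2" by (simp add: power2_diff power_divide)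
      also have "\<dots> \<le> 1/24 + 48 * ((v n p - u p)\<^sup>2 + ?h\<^sup>2 + ?k\<^sup>2)"
      proof -
        have "1/24 + 24 * x \<le> 1/24 + 48 * (z + y + w)" if "x \<le> 2 * y + 2 * w" "0 \<le> z" for x y z w :: real
          using that by simp
        then show ?thesis using * zero_le_power2 by blast
      qed
      finally have "l^2/t * (2 * ?g) \<le> l^2/t * (1/24 + 48 * ((v n p - u p)\<^sup>2 + ?h\<^sup>2 + ?k\<^sup>2))"
        using \<open>0 < t\<close> by (intro mult_left_mono) auto
      then have "2 * l^2 / t * ?g \<le> l^2/(24*t) + (48 * l^2 / t) * (((v n p - u p)\<^sup>2 + ?h\<^sup>2) + ?k\<^sup>2)"
        by (simp add: algebra_simps)
      then show ?thesis using \<open>0 < t\<close>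
        by (simp add: ennreal_leI flip: ennreal_plus ennreal_mult)
    qed
    then have "(\<integral>\<^sup>+p. ennreal (2 * l^2 / t * norm (gradient (v n) p)) \<partial>lebesgue_on ?R)
      \<le> (\<integral>\<^sup>+p. ennreal (l^2/(24*t)) + ennreal (48 * l^2 / t) * (ennreal ((v n p - u p)\<^sup>2 + (norm (gradient (v n) p - G p))\<^sup>2)
          + ennreal ((norm (G p))\<^sup>2)) \<partial>lebesgue_on ?R)"
      by (intro nn_integral_mono)
    also have "\<dots> = ennreal (l^2/(24*t)) * emeasure lebesgue ?R + ennreal (48 * l^2 / t) * (D n + E)"
    proof -
      define f1 where "f1 p = ennreal ((v n p - u p)\<^sup>2 + (norm (gradient (v n) p - G p))\<^sup>2)" for p
      define f2 where "f2 p = ennreal ((norm (G p))\<^sup>2)" for p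
      have [measurable]: "f1 \<in> borel_measurable (lebesgue_on ?R)" "f2 \<in> borel_measurable (lebesgue_on ?R)"
        unfolding f1_def f2_def by measurable
      show ?thesis
        unfolding D_def E_def eq f1_def[symmetric] f2_def[symmetric] using Rs
        by (simp add: nn_integral_add nn_integral_cmult emeasure_restrict_space)
    qed
    also have "emeasure lebesgue ?R = ennreal (l * t)"
      using l \<open>a < b\<close> \<open>0 < t\<close> unfolding R l_def
      by (simp add: emeasure_lborel_box_eq Basis_prod_def ennreal_mult mult.commute)
    also have "ennreal (l^2/(24*t)) * ennreal (l * t) = ennreal (l^3/24)"
      using l \<open>0 < t\<close> by (simp add: power2_eq_square power3_eq_cube flip: ennreal_mult)
    finally show ?thesis unfolding eq .
  qed
  have "ennreal (l^3/6) \<le> ennreal (l^3/12) + (6 * d n + ennreal (48 * l^2 / t) * (D n + E))" for n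
  proof -
    have "ennreal (l^3/6) \<le> (ennreal (l^3/24) + 6 * d n) + (ennreal (l^3/24) + ennreal (48 * l^2 / t) * (D n + E))"
      using smooth_rectangle_estimate[OF v \<open>a < b\<close> \<open>0 < t\<close> \<open>t \<le> b - a\<close>, of n] add_mono[OF bottom[of n] bulk[of n]]
      by (simp add: box_pair l_def)
    also have "\<dots> = (ennreal (l^3/24) + ennreal (l^3/24)) + (6 * d n + ennreal (48 * l^2 / t) * (D n + E))"
      by (simp add: ac_simps)
    also have "ennreal (l^3/24) + ennreal (l^3/24) = ennreal (l^3/12)"
      using l by (simp flip: ennreal_plus)
    finally show ?thesis .
  qed
  moreover have "(\<lambda>n. ennreal (l^3/12) + (6 * d n + ennreal (48 * l^2 / t) * (D n + E)))
     \<longlonglongrightarrow> ennreal (l^3/12) + (6 * 0 + ennreal (48 * l^2 / t) * (0 + E))"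
    using D d unfolding d_def[symmetric] D_def[symmetric]
    by (intro tendsto_add tendsto_const ennreal_tendsto_cmult) auto
  ultimately have lim: "ennreal (l^3/6) \<le> ennreal (l^3/12) + ennreal (48 * l^2 / t) * E"
    by (intro LIMSEQ_le_const) auto
  show ?thesis
  proof (cases "E = \<infinity>")
    case False
    then obtain e where e: "E = ennreal e" "0 \<le> e" by (cases E) auto
    have "l^3/6 \<le> l^3/12 + (48 * l^2 / t) * e"
      using lim e l \<open>0 < t\<close> by (simp flip: ennreal_mult ennreal_plus)
    then have "l^2 * (l * t) \<le> l^2 * (576 * e)"
      using \<open>0 < t\<close> by (simp add: field_simps power2_eq_square power3_eq_cube)
    then have "l * t \<le> 576 * e" using l by (subst (asm) mult_le_cancel_left_pos) auto
    then show ?thesis using e unfolding E_def[unfolded G_def] l_def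
      by (metis divide_le_eq ennreal_leI mult.commute zero_less_numeral)
  qed (simp add: E_def[unfolded G_def])
qed

section \<open>Volume in terms of energy\<close>

text \<open>\<open>W x\<close> is the variation of \<open>h\<close> on the half-line up to \<open>x\<close>. With it the variations of \<open>h\<close> on
  successive cells telescope.\<close>

lemma bounded_variation_majorant:
  assumes TV: "pointwise_variation h \<le> ennreal K" and "0 \<le> K"
  obtains W where "\<And>x. 0 \<le> W x" "\<And>x. W x \<le> K" "\<And>x y. x \<le> y \<Longrightarrow> \<bar>h y - h x\<bar> \<le> W y - W x"
proof -
  define \<sigma> where "\<sigma> n z = (\<Sum>i=1..n. \<bar>h (z i) - h (z (i - 1))\<bar>)" for n :: nat and z :: "nat \<Rightarrow> real"
  define S where "S x = {\<sigma> n z | n z. strict_mono_on {..n} z \<and> z n = x}" for x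
  define W where "W x = Sup (S x)" for x
  have le: "s \<le> K" if "s \<in> S x" for s x
  proof -
    obtain n z where z: "s = \<sigma> n z" "strict_mono_on {..n} z" using \<open>s \<in> S x\<close> by (auto simp: S_def)
    have "ennreal s \<le> pointwise_variation h"
      unfolding pointwise_variation_def z(1) \<sigma>_def
      by (rule SUP_upper2[of "(n,z)"]) (use z in auto)
    then show ?thesis using TV \<open>0 \<le> K\<close> by (meson ennreal_le_iff order_trans)
  qed
  have zero: "0 \<in> S x" for x
    unfolding S_def \<sigma>_def by (rule CollectI, rule exI[of _ 0], rule exI[of _ "\<lambda>_. x"]) (auto simp: strict_mono_on_def)
  have bdd: "bdd_above (S x)" for x using le by (intro bdd_aboveI) auto
  show thesis
  proof
    show "0 \<le> W x" for x unfolding W_def by (rule cSup_upper[OF zero bdd])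
    show "W x \<le> K" for x unfolding W_def using zero le by (intro cSup_least) auto
    show "\<bar>h y - h x\<bar> \<le> W y - W x" if "x \<le> y" for x y
    proof (cases "x = y")
      case False
      have "s \<le> W y - \<bar>h y - h x\<bar>" if "s \<in> S x" for s
      proof -
        obtain n z where z: "s = \<sigma> n z" "strict_mono_on {..n} z" "z n = x"
          using \<open>s \<in> S x\<close> by (auto simp: S_def)
        define z' where "z' = z(Suc n := y)"
        have zx: "z i \<le> x" if "i \<le> n" for i
          using strict_mono_onD[OF z(2), of i n] that z(3) by (cases "i = n") auto
        have "strict_mono_on {..Suc n} z'"
        proof (rule strict_mono_onI)
          fix i j assume ij: "i \<in> {..Suc n}" "j \<in> {..Suc n}" "i < j"
          show "z' i < z' j"
          proof (cases "j = Suc n")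
            case True
            then show ?thesis using ij zx[of i] \<open>x \<le> y\<close> \<open>x \<noteq> y\<close> by (simp add: z'_def)
          next
            case False
            then show ?thesis using ij strict_mono_onD[OF z(2), of i j] by (simp add: z'_def)
          qed
        qed
        moreover have "\<sigma> (Suc n) z' = s + \<bar>h y - h x\<bar>"
        proof -
          have "(\<Sum>i=1..n. \<bar>h (z' i) - h (z' (i - 1))\<bar>) = \<sigma> n z"
            unfolding \<sigma>_def z'_def by (intro sum.cong) auto
          then show ?thesis using z by (simp add: \<sigma>_def z'_def)
        qed
        ultimately have "s + \<bar>h y - h x\<bar> \<in> S y"
          unfolding S_def by (metis (mono_tags, lifting) CollectI fun_upd_same z'_def)
        then show ?thesis using cSup_upper[OF _ bdd[of y]] by (fastforce simp: W_def)
      qed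
      then have "W x \<le> W y - \<bar>h y - h x\<bar>"
        unfolding W_def[of x] using zero by (intro cSup_least) auto
      then show ?thesis by simp
    qed simp
  qed
qed

text \<open>Otherwise \<open>h\<close> would be bounded below by a positive constant on the whole line.\<close>

lemma integrable_oscillation_bound:
  fixes h :: "real \<Rightarrow> real"
  assumes "integrable lebesgue h" and osc: "\<And>y. \<bar>h y - h x\<bar> \<le> K"
  shows "h x \<le> K"
proof (rule ccontr)
  assume "\<not> h x \<le> K"
  then have "0 < h x - K" by simp
  have "ennreal (h x - K) * emeasure lebesgue (UNIV :: real set) = (\<integral>\<^sup>+y. ennreal (h x - K) \<partial>(lebesgue :: real measure))"
    by simp
  also have "\<dots> \<le> (\<integral>\<^sup>+y. ennreal (norm (h y)) \<partial>lebesgue)"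
    using osc by (intro nn_integral_mono ennreal_leI) (smt (verit) real_norm_def)
  also have "\<dots> < \<infinity>" using assms(1) by (simp add: integrable_iff_bounded)
  finally show False using \<open>0 < h x - K\<close> by (simp add: ennreal_mult_top)
qed

lemma open_subgraph:
  assumes "lower_semicontinuous h"
  shows "open (subgraph h)"
proof -
  have "\<exists>T. open T \<and> p \<in> T \<and> T \<subseteq> subgraph h" if "p \<in> subgraph h" for p
  proof -
    obtain x y where p: "p = (x,y)" "0 < y" "y < h x"
      using \<open>p \<in> subgraph h\<close> by (auto simp: subgraph_def)
    obtain a where a: "y < a" "a < h x" using dense p(3) by blast
    then obtain U where U: "open U" "x \<in> U" "\<And>z. z \<in> U \<Longrightarrow> a < h z"
      using assms unfolding lower_semicontinuous_def eventually_nhds by meson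
    have "open (U \<times> {0<..<a})" "p \<in> U \<times> {0<..<a}" "U \<times> {0<..<a} \<subseteq> subgraph h"
      using U a p by (auto intro: open_Times simp: subgraph_def dest!: U(3))
    then show ?thesis by blast
  qed
  then show ?thesis by (subst open_subopen) blast
qed

text \<open>The line is cut into the cells between \<open>q i = i * s\<close> and \<open>q (i + 1)\<close>. Over a cell, \<open>h\<close> is at most its
  infimum \<open>m i\<close> plus the increment \<open>\<Delta> i\<close> of the running variation. The rectangle \<open>R i\<close>
  of height \<open>t i = min (m i) s\<close> has elastic energy at least \<open>s * t i / 576\<close>, and
  \<open>m i \<le> (1 + M/s) * t i\<close>. The rectangles are disjoint and the increments telescope, so the
  bound does not depend on the number of cells.\<close>

lemma volume_bound:
  assumes adm: "(u, h) \<in> admissible V"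
    and TV: "pointwise_variation h \<le> ennreal K" "0 \<le> K"
    and EL: "(\<integral>\<^sup>+p\<in>subgraph h. ennreal ((norm (weak_gradient (subgraph h) u p))\<^sup>2) \<partial>lebesgue) \<le> ennreal L" "0 \<le> L"
    and "0 < s" and M: "\<And>x. h x \<le> M"
  shows "V \<le> s * K + 576 * (1 + M / s) * L"
proof -
  define \<Omega> where "\<Omega> = subgraph h"
  obtain T where h: "integrable lebesgue h" "lower_semicontinuous h" "\<And>x. 0 \<le> h x" "(LINT x|lebesgue. h x) = V"
    and u: "u \<in> H1 \<Omega>" and T: "is_bottom_trace \<Omega> u T"
    and Tx: "AE x in lebesgue. x \<in> closure {x. h x \<noteq> 0} \<longrightarrow> T x = x"
    using adm unfolding admissible_def BV_def \<Omega>_def by blast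
  obtain W where W: "\<And>x. 0 \<le> W x" "\<And>x. W x \<le> K" "\<And>x y. x \<le> y \<Longrightarrow> \<bar>h y - h x\<bar> \<le> W y - W x"
    using bounded_variation_majorant[OF TV] by blast
  have "0 \<le> M" using M[of 0] h(3)[of 0] by simp
  have "open \<Omega>" using open_subgraph h(2) by (simp add: \<Omega>_def)
  then have \<Omega>: "\<Omega> \<in> sets lebesgue" by simp
  define g where "g p = ennreal ((norm (weak_gradient \<Omega> u p))\<^sup>2) * indicator \<Omega> p" for p
  have "weak_gradient \<Omega> u \<in> L2 \<Omega>" by (rule weak_gradient_in_L2[OF u])
  then have [measurable]: "weak_gradient \<Omega> u \<in> borel_measurable (lebesgue_on \<Omega>)" by (simp add: L2_def)
  have [measurable]: "g \<in> borel_measurable lebesgue"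
  proof -
    have "(\<lambda>p. ennreal ((norm (weak_gradient \<Omega> u p))\<^sup>2)) \<in> borel_measurable (lebesgue_on \<Omega>)" by measurable
    then show ?thesis
      using \<Omega> unfolding g_def by (subst (asm) borel_measurable_restrict_space_iff_ennreal) auto
  qed
  define q where "q i = real_of_int i * s" for i
  define \<Delta> where "\<Delta> i = W (q (i+1)) - W (q i)" for i
  have q_Suc: "q (i+1) = q i + s" for i by (simp add: q_def algebra_simps)
  have q_mono: "q i \<le> q j" if "i \<le> j" for i j
    using that \<open>0 < s\<close> by (auto simp: q_def intro!: mult_right_mono)
  define m where "m i = Inf (h ` {q i..q (i+1)})" for i
  define t where "t i = min (m i) s" for i
  define R where "R i = {q i<..<q (i+1)} \<times> {0<..<t i}" for i
  have step: "q i \<le> q (i+1)" for i by (rule q_mono) simp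
  have \<Delta>0: "0 \<le> \<Delta> i" for i using W(3)[OF step[of i]] by (simp add: \<Delta>_def)
  have m_le: "m i \<le> h x" if "x \<in> {q i..q (i+1)}" for i x
    unfolding m_def using that h(3) by (intro cINF_lower bdd_belowI[of _ 0]) auto
  have m_ge: "c \<le> m i" if "\<And>x. x \<in> {q i..q (i+1)} \<Longrightarrow> c \<le> h x" for i c
    unfolding m_def using that step[of i] by (intro cINF_greatest) auto
  have m0: "0 \<le> m i" for i by (rule m_ge) (rule h(3))
  have mM: "m i \<le> M" for i
    using m_le[of "q i" i] M[of "q i"] step[of i] by simp
  have Rsub: "R i \<subseteq> \<Omega>" for i
  proof
    fix p assume "p \<in> R i"
    then show "p \<in> \<Omega>"
      using m_le[of "fst p" i] by (auto simp: R_def \<Omega>_def subgraph_def t_def)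
  qed
  have R_sets [measurable]: "R i \<in> sets lebesgue" for i
    by (simp add: R_def flip: box_pair)
  have cell: "ennreal (s * m i) \<le> ennreal (576 * (1 + M / s)) * (\<integral>\<^sup>+p. g p * indicator (R i) p \<partial>lebesgue)" for i
  proof (cases "m i = 0")
    case False
    then have "0 < m i" using m0[of i] by simp
    then have t: "0 < t i" using \<open>0 < s\<close> by (simp add: t_def)
    have "{q i<..<q (i+1)} \<subseteq> closure {x. h x \<noteq> 0}"
    proof
      fix x assume "x \<in> {q i<..<q (i+1)}"
      then have "h x \<noteq> 0" using m_le[of x i] \<open>0 < m i\<close> by auto
      then show "x \<in> closure {x. h x \<noteq> 0}" using closure_subset[of "{x. h x \<noteq> 0}"] by auto
    qed
    then have "AE x in lebesgue. x \<in> {q i<..<q (i+1)} \<longrightarrow> T x = x"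
      using Tx by (auto elim!: eventually_mono)
    from rectangle_energy_bound[OF u T this _ t _ Rsub[of i, unfolded R_def] \<Omega>]
    have "ennreal ((q (i+1) - q i) * t i / 576)
      \<le> (\<integral>\<^sup>+p\<in>R i. ennreal ((norm (weak_gradient \<Omega> u p))\<^sup>2) \<partial>lebesgue)"
      using \<open>0 < s\<close> by (simp add: R_def t_def q_Suc)
    also have "\<dots> = (\<integral>\<^sup>+p. g p * indicator (R i) p \<partial>lebesgue)"
      using Rsub[of i] by (intro nn_integral_cong) (auto simp: g_def split: split_indicator)
    finally have e: "ennreal (s * t i / 576) \<le> (\<integral>\<^sup>+p. g p * indicator (R i) p \<partial>lebesgue)"
      by (simp add: q_Suc)
    \<comment> \<open>If \<open>m i \<le> s\<close> then \<open>t i = m i\<close>, otherwise \<open>t i = s\<close> and \<open>m i \<le> M = (M/s) * s\<close>.\<close>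
    have "m i \<le> (1 + M / s) * t i"
    proof (cases "m i \<le> s")
      case True
      then show ?thesis using \<open>0 \<le> M\<close> \<open>0 < s\<close> m0[of i] by (simp add: t_def distrib_right)
    next
      case False
      then show ?thesis using mM[of i] \<open>0 < s\<close> by (simp add: t_def distrib_right)
    qed
    then have "s * m i \<le> s * ((1 + M / s) * t i)" using \<open>0 < s\<close> by simp
    also have "\<dots> = 576 * (1 + M / s) * (s * t i / 576)" by simp
    finally have "s * m i \<le> 576 * (1 + M / s) * (s * t i / 576)" .
    then have "ennreal (s * m i) \<le> ennreal (576 * (1 + M / s)) * ennreal (s * t i / 576)"
      using \<open>0 < s\<close> t \<open>0 \<le> M\<close> by (subst ennreal_mult[symmetric]) (auto intro!: ennreal_leI simp del: ennreal_plus)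
    also have "\<dots> \<le> ennreal (576 * (1 + M / s)) * (\<integral>\<^sup>+p. g p * indicator (R i) p \<partial>lebesgue)"
      using e by (rule mult_left_mono) simp
    finally show ?thesis .
  qed simp
  define J where "J i = {q i..<q (i+1)}" for i
  have J_sets [measurable]: "J i \<in> sets lebesgue" for i by (simp add: J_def)
  \<comment> \<open>The \<open>2 * N\<close> cells around the origin; the bound is uniform in \<open>N\<close>.\<close>
  have part: "(\<integral>\<^sup>+x\<in>{- real N * s..<real N * s}. ennreal (h x) \<partial>lebesgue) \<le> ennreal (s * K + 576 * (1 + M / s) * L)" for N
  proof -
    let ?Z = "{- int N..<int N}" and ?C = "576 * (1 + M / s)"
    have disj: "disjoint_family_on R ?Z"
    proof -
      have no: False if "i < j" "p \<in> R i" "p \<in> R j" for i j p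
      proof -
        have "q (i+1) \<le> q j" using that by (intro q_mono) auto
        then show False using that by (auto simp: R_def)
      qed
      show ?thesis unfolding disjoint_family_on_def
      proof (intro ballI impI)
        fix i j :: int assume "i \<noteq> j"
        then consider "i < j" | "j < i" by linarith
        then show "R i \<inter> R j = {}" using no by cases blast+
      qed
    qed
    have "ennreal (h x) * indicator {- real N * s..<real N * s} x
      \<le> (\<Sum>i\<in>?Z. ennreal (m i + \<Delta> i) * indicator (J i) x)" for x
    proof (cases "x \<in> {- real N * s..<real N * s}")
      case True
      define i where "i = \<lfloor>x / s\<rfloor>"
      have "real_of_int i \<le> x / s" "x / s < real_of_int i + 1"
        unfolding i_def by linarith+
      then have xi: "q i \<le> x" "x < q (i+1)"
        using \<open>0 < s\<close> by (simp_all add: q_def pos_le_divide_eq pos_divide_less_eq)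
      have "- real N \<le> x / s" "x / s < real N" using True \<open>0 < s\<close>
        by (simp_all add: pos_le_divide_eq pos_divide_less_eq)
      then have iZ: "i \<in> ?Z" by (simp add: i_def le_floor_iff floor_less_iff)
      have "h x - \<Delta> i \<le> m i"
      proof (rule m_ge)
        fix y assume y: "y \<in> {q i..q (i+1)}"
        have mono: "W a \<le> W b" if "a \<le> b" for a b using W(3)[OF that] by simp
        have "W (q i) \<le> W x" "W x \<le> W (q (i+1))" "W (q i) \<le> W y" "W y \<le> W (q (i+1))"
          using xi y by (auto intro: mono)
        then have "\<bar>W x - W y\<bar> \<le> \<Delta> i" unfolding \<Delta>_def by linarith
        moreover have "\<bar>h x - h y\<bar> \<le> \<bar>W x - W y\<bar>"
        proof (cases "x \<le> y")
          case True
          then show ?thesis using W(3)[OF True] by linarith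
        next
          case False
          then show ?thesis using W(3)[of y x] by linarith
        qed
        ultimately show "h x - \<Delta> i \<le> h y" by linarith
      qed
      then have "ennreal (h x) * indicator {- real N * s..<real N * s} x
        \<le> ennreal (m i + \<Delta> i) * indicator (J i) x"
        using True xi by (auto simp: J_def intro!: ennreal_leI)
      also have "\<dots> \<le> (\<Sum>i\<in>?Z. ennreal (m i + \<Delta> i) * indicator (J i) x)"
        by (rule member_le_sum[OF iZ]) auto
      finally show ?thesis .
    qed simp
    then have "(\<integral>\<^sup>+x\<in>{- real N * s..<real N * s}. ennreal (h x) \<partial>lebesgue)
      \<le> (\<integral>\<^sup>+x. (\<Sum>i\<in>?Z. ennreal (m i + \<Delta> i) * indicator (J i) x) \<partial>lebesgue)"
      by (rule nn_integral_mono)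
    also have "\<dots> = (\<Sum>i\<in>?Z. ennreal (m i + \<Delta> i) * emeasure lebesgue (J i))"
      by (subst nn_integral_sum, measurable) (simp only: nn_integral_cmult_indicator[OF J_sets])
    also have "\<dots> = (\<Sum>i\<in>?Z. ennreal (s * m i) + ennreal (s * \<Delta> i))"
    proof (intro sum.cong refl)
      fix i
      have "emeasure lebesgue (J i) = ennreal s"
        using step[of i] by (simp add: J_def q_Suc)
      then have "ennreal (m i + \<Delta> i) * emeasure lebesgue (J i) = ennreal ((m i + \<Delta> i) * s)"
        using m0[of i] \<Delta>0[of i] \<open>0 < s\<close> by (simp only: ennreal_mult add_nonneg_nonneg less_imp_le)
      also have "(m i + \<Delta> i) * s = s * m i + s * \<Delta> i" by (simp add: algebra_simps)
      also have "ennreal (s * m i + s * \<Delta> i) = ennreal (s * m i) + ennreal (s * \<Delta> i)"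
        using m0[of i] \<Delta>0[of i] \<open>0 < s\<close> by (intro ennreal_plus) auto
      finally show "ennreal (m i + \<Delta> i) * emeasure lebesgue (J i) = ennreal (s * m i) + ennreal (s * \<Delta> i)" .
    qed
    also have "\<dots> = (\<Sum>i\<in>?Z. ennreal (s * m i)) + (\<Sum>i\<in>?Z. ennreal (s * \<Delta> i))"
      by (rule sum.distrib)
    also have "\<dots> \<le> ennreal (?C * L) + ennreal (s * K)"
    proof (rule add_mono)
      have "(\<Sum>i\<in>?Z. ennreal (s * m i)) \<le> (\<Sum>i\<in>?Z. ennreal ?C * (\<integral>\<^sup>+p. g p * indicator (R i) p \<partial>lebesgue))"
        by (intro sum_mono cell)
      also have "\<dots> = ennreal ?C * (\<integral>\<^sup>+p. (\<Sum>i\<in>?Z. g p * indicator (R i) p) \<partial>lebesgue)"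
        by (subst nn_integral_sum, measurable) (simp only: sum_distrib_left)
      also have "\<dots> \<le> ennreal ?C * (\<integral>\<^sup>+p. g p \<partial>lebesgue)"
      proof (intro mult_left_mono nn_integral_mono)
        fix p
        have "(\<Sum>i\<in>?Z. g p * indicator (R i) p) = g p * indicator (\<Union>i\<in>?Z. R i) p"
          by (simp only: indicator_UN_disjoint[OF finite_atLeastLessThan_int disj] sum_distrib_left)
        also have "\<dots> \<le> g p" by (auto split: split_indicator)
        finally show "(\<Sum>i\<in>?Z. g p * indicator (R i) p) \<le> g p" .
      qed simp
      also have "\<dots> \<le> ennreal ?C * ennreal L"
        using EL(1) by (intro mult_left_mono) (auto simp: g_def \<Omega>_def)
      finally show "(\<Sum>i\<in>?Z. ennreal (s * m i)) \<le> ennreal (?C * L)"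
        using \<open>0 \<le> M\<close> \<open>0 < s\<close> \<open>0 \<le> L\<close> by (simp add: ennreal_mult)
      have "(\<Sum>i\<in>?Z. ennreal (s * \<Delta> i))
        = ennreal (\<Sum>i\<in>?Z. s * \<Delta> i)"
        using \<Delta>0 \<open>0 < s\<close> by (intro sum_ennreal) simp
      also have "(\<Sum>i\<in>?Z. s * \<Delta> i) = s * (W (real N * s) - W (- real N * s))"
      proof (induction N)
        case (Suc N)
        have eq: "{- int (Suc N)..<int (Suc N)} = insert (int N) (insert (- int (Suc N)) {- int N..<int N})" by auto
        have "(\<Sum>i\<in>{- int (Suc N)..<int (Suc N)}. s * \<Delta> i)
          = s * \<Delta> (int N) + (s * \<Delta> (- int (Suc N)) + (\<Sum>i\<in>{- int N..<int N}. s * \<Delta> i))"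
          by (subst eq, subst sum.insert, simp, simp, subst sum.insert, simp, simp, rule refl)
        also have "\<Delta> (int N) = W (real (Suc N) * s) - W (real N * s)"
          by (simp add: \<Delta>_def q_def add.commute)
        also have "\<Delta> (- int (Suc N)) = W (- real N * s) - W (- real (Suc N) * s)"
          by (simp add: \<Delta>_def q_def add.commute)
        also note Suc
        finally show ?case by (simp only: right_diff_distrib)
      qed simp
      also have "\<dots> \<le> s * K"
        using W(1)[of "- real N * s"] W(2)[of "real N * s"] \<open>0 < s\<close> by (intro mult_left_mono) linarith+
      finally show "(\<Sum>i\<in>?Z. ennreal (s * \<Delta> i)) \<le> ennreal (s * K)"
        by (simp add: ennreal_leI)
    qed
    also have "\<dots> = ennreal (s * K + ?C * L)"
      using \<open>0 \<le> M\<close> \<open>0 < s\<close> \<open>0 \<le> L\<close> \<open>0 \<le> K\<close> by (subst ennreal_plus) (simp_all add: add.commute)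
    finally show ?thesis .
  qed
  have h_meas: "h \<in> borel_measurable lebesgue" using h(1) by (rule borel_measurable_integrable)
  have "ennreal V = (\<integral>\<^sup>+x. ennreal (h x) \<partial>lebesgue)"
    using nn_integral_eq_integral[OF h(1)] h by simp
  also have "\<dots> = (\<integral>\<^sup>+x. (SUP N. ennreal (h x) * indicator {- real N * s..<real N * s} x) \<partial>lebesgue)"
  proof (rule nn_integral_cong)
    fix x
    obtain N :: nat where "\<bar>x\<bar> / s < real N" using reals_Archimedean2 by blast
    then have "x \<in> {- real N * s..<real N * s}" using \<open>0 < s\<close> by (simp add: pos_divide_less_eq) linarith
    then show "ennreal (h x) = (SUP N. ennreal (h x) * indicator {- real N * s..<real N * s} x)"
      by (intro antisym SUP_upper2[of N] SUP_least) (auto split: split_indicator)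
  qed
  also have "\<dots> = (SUP N. \<integral>\<^sup>+x. ennreal (h x) * indicator {- real N * s..<real N * s} x \<partial>lebesgue)"
  proof (rule nn_integral_monotone_convergence_SUP)
    show "incseq (\<lambda>N x. ennreal (h x) * indicator {- real N * s..<real N * s} x)"
    proof (intro monoI le_funI mult_left_mono)
      fix N N' :: nat and x assume "N \<le> N'"
      then have "real N * s \<le> real N' * s" using \<open>0 < s\<close> by (intro mult_right_mono) auto
      then show "indicator {- real N * s..<real N * s} x \<le> (indicator {- real N' * s..<real N' * s} x :: ennreal)"
        by (simp add: indicator_def)
    qed simp
    show "(\<lambda>x. ennreal (h x) * indicator {- real N * s..<real N * s} x) \<in> borel_measurable lebesgue" for N
      by (intro borel_measurable_times_ennreal borel_measurable_indicator measurable_compose[OF _ measurable_ennreal] h_meas) simp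
  qed
  also have "\<dots> \<le> ennreal (s * K + 576 * (1 + M / s) * L)"
    using part by (intro SUP_least)
  finally have "ennreal V \<le> ennreal (s * K + 576 * (1 + M / s) * L)" .
  moreover have "0 \<le> s * K + 576 * (1 + M / s) * L"
    using \<open>0 \<le> M\<close> \<open>0 < s\<close> \<open>0 \<le> L\<close> \<open>0 \<le> K\<close> by simp
  ultimately show ?thesis using ennreal_le_iff by blast
qed

lemma energy_volume_inequality:
  assumes adm: "(u, h) \<in> admissible V" and E: "energy u h \<le> ennreal E" "0 \<le> E"
    and "0 < s" "\<And>x. h x \<le> M"
  shows "V \<le> s * E + 576 * (1 + M / s) * E"
proof (rule volume_bound[OF adm])
  show "pointwise_variation h \<le> ennreal E"
    by (rule order_trans[OF _ E(1)[unfolded energy_def]]) (simp add: add_increasing)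
  show "(\<integral>\<^sup>+p\<in>subgraph h. ennreal ((norm (weak_gradient (subgraph h) u p))\<^sup>2) \<partial>lebesgue) \<le> ennreal E"
    by (rule order_trans[OF _ E(1)[unfolded energy_def]]) (simp add: add_increasing2)
qed (use assms in auto)

lemma profile_le_energy:
  assumes adm: "(u, h) \<in> admissible V" and E: "energy u h \<le> ennreal E" "0 \<le> E"
  shows "h x \<le> E"
proof (rule integrable_oscillation_bound[of h x E])
  show "integrable lebesgue h" using adm by (auto simp: admissible_def BV_def)
  have "pointwise_variation h \<le> ennreal E"
    by (rule order_trans[OF _ E(1)[unfolded energy_def]]) (simp add: add_increasing)
  then obtain W where W: "\<And>x. 0 \<le> W x" "\<And>x. W x \<le> E" "\<And>x y. x \<le> y \<Longrightarrow> \<bar>h y - h x\<bar> \<le> W y - W x"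
    using bounded_variation_majorant[OF _ E(2)] by blast
  show "\<bar>h y - h x\<bar> \<le> E" for y
    using W(3)[of x y] W(3)[of y x] W(1)[of x] W(1)[of y] W(2)[of x] W(2)[of y]
    by (cases "x \<le> y") linarith+
qed

text \<open>The height is bounded by \<open>E\<close> itself, and the cell size \<open>sqrt E\<close> balances the two terms
  \<open>s * E\<close> and \<open>E\<^sup>2 / s\<close>. The constant is \<open>577 + 576\<close>.\<close>

lemma energy_lower_bound:
  assumes adm: "(u, h) \<in> admissible V" and E: "energy u h \<le> ennreal E" "0 \<le> E" and "0 < V"
  shows "min V (V powr (2/3)) \<le> 1153 * E"
proof -
  note M = profile_le_energy[OF adm E]
  have "0 < E"
    using energy_volume_inequality[OF adm E zero_less_one M] \<open>0 < V\<close> \<open>0 \<le> E\<close> by (cases "E = 0") auto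
  have "V \<le> sqrt E * E + 576 * (1 + E / sqrt E) * E"
    using energy_volume_inequality[OF adm E _ M, of "sqrt E"] \<open>0 < E\<close> by simp
  also have "\<dots> = 577 * (E * sqrt E) + 576 * E"
    using \<open>0 < E\<close> by (simp add: real_div_sqrt algebra_simps)
  finally have V: "V \<le> 577 * (E * sqrt E) + 576 * E" .
  show ?thesis
  proof (cases "E \<le> 1")
    case True
    then have "E * sqrt E \<le> E * 1" using \<open>0 < E\<close> by (intro mult_left_mono) auto
    then have "V \<le> 1153 * E" using V by simp
    then show ?thesis by simp
  next
    case False
    then have "E * 1 \<le> E * sqrt E" by (intro mult_left_mono) auto
    then have "V \<le> 1153 * (E * sqrt E)" using V by simp
    also have "E * sqrt E = E powr (3/2)"
      using \<open>0 < E\<close> powr_add[of E 1 "1/2"] by (simp add: powr_half_sqrt)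
    finally have "V powr (2/3) \<le> (1153 * E powr (3/2)) powr (2/3)"
      using \<open>0 < V\<close> by (intro powr_mono2) auto
    also have "\<dots> = 1153 powr (2/3) * E"
      using \<open>0 < E\<close> by (simp add: powr_mult powr_powr)
    also have "\<dots> \<le> 1153 powr 1 * E"
      using \<open>0 < E\<close> by (intro mult_right_mono powr_mono) auto
    finally show ?thesis by simp
  qed
qed

text \<open>Let \<open>w\<close> be the cube root of \<open>V\<close>, so that the energy is at most \<open>1153 * w\<^sup>2\<close>, and suppose that \<open>h\<close> is
  bounded by \<open>M = c * w\<^sup>2\<close>. For the cell size \<open>w/2306\<close>, which is \<open>w / (2 * 1153)\<close>, the three
  terms that bound \<open>V = w^3\<close> are \<open>w^3/2\<close>, a multiple of \<open>w\<^sup>2\<close>, and a multiple of \<open>c * w^3\<close>. The threshold for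
  \<open>V\<close> and the constant \<open>c\<close> make each of the last two at most \<open>w^3/8\<close>.\<close>

lemma sup_lower_bound:
  assumes adm: "(u, h) \<in> admissible V"
    and E: "energy u h \<le> ennreal (1153 * min V (V powr (2/3)))"
    and V: "(8 * 576 * 1153) ^ 3 \<le> V"
  shows "ennreal (1 / (8 * 576 * 1153 * 2306) * V powr (2/3)) \<le> (SUP x. ennreal (h x))"
proof (rule ccontr)
  define w where "w = V powr (1/3)"
  define M where "M = 1 / (8 * 576 * 1153 * 2306) * w^2"
  have "0 < V" using V by (rule less_le_trans[rotated]) simp
  then have "0 < w" by (simp add: w_def)
  have w2: "V powr (2/3) = w^2" and w3: "V = w^3"
    using \<open>0 < V\<close> by (simp_all add: w_def powr_powr flip: powr_numeral)
  have "(8 * 576 * 1153) ^ 3 \<le> w ^ 3" using V w3 by simp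
  then have w: "8 * 576 * 1153 \<le> w" using \<open>0 < w\<close> by (subst (asm) power_mono_iff) auto
  assume "\<not> ?thesis"
  then have "(SUP x. ennreal (h x)) < ennreal M" by (simp add: w2 M_def not_le)
  then have "ennreal (h x) \<le> ennreal M" for x
    by (meson SUP_upper UNIV_I less_imp_le order_trans)
  moreover have "0 \<le> M" by (simp add: M_def)
  ultimately have M: "h x \<le> M" for x by simp
  have "energy u h \<le> ennreal (1153 * w^2)"
    using E by (rule order_trans) (auto intro!: ennreal_leI simp: w2)
  from energy_volume_inequality[OF adm this _ _ M, of "w / 2306"]
  have "w^3 \<le> w / 2306 * (1153 * w^2) + 576 * (1 + M / (w / 2306)) * (1153 * w^2)"
    using \<open>0 < w\<close> w3 by simp
  also have "\<dots> = w^3 / 2 + 576 * 1153 * w^2 + w^3 / 8"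
    using \<open>0 < w\<close> by (simp add: M_def field_simps power2_eq_square power3_eq_cube)
  also have "576 * 1153 * w^2 \<le> w^3 / 8"
    using mult_right_mono[OF w, of "w^2"] by (simp add: power2_eq_square power3_eq_cube)
  finally have "w^3 \<le> 3/4 * w^3" by simp
  then show False using \<open>0 < w\<close> by simp
qed

lemma F_ell_lower_bound:
  assumes "0 < V"
  shows "ennreal (1 / 1153 * min V (V powr (2/3))) \<le> F_ell V"
  unfolding F_ell_def
proof (rule INF_greatest, clarify)
  fix u h assume adm: "(u, h) \<in> admissible V"
  show "ennreal (1 / 1153 * min V (V powr (2/3))) \<le> energy u h"
  proof (cases "energy u h")
    case (real E)
    then have "min V (V powr (2/3)) \<le> 1153 * E"
      using energy_lower_bound[OF adm _ _ assms] by simp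
    then have "ennreal (1 / 1153 * min V (V powr (2/3))) \<le> ennreal E" by (intro ennreal_leI) simp
    then show ?thesis using real by simp
  qed simp
qed

section \<open>Smooth functions with compact support in a rectangle\<close>

text \<open>The index \<open>m\<close> makes the family closed under differentiation up to linear combinations.
  Only \<open>flat 0\<close>, the standard smooth function that vanishes exactly on the nonpositive half-line, enters
  the test functions.\<close>

definition flat :: "nat \<Rightarrow> real \<Rightarrow> real" where
  "flat m t = (if t \<le> 0 then 0 else exp (- 1 / t) / t ^ m)"

lemma flat_tendsto_0: "(flat m \<longlongrightarrow> 0) (at 0)"
proof -
  have "((\<lambda>t. inverse t ^ m / exp (inverse t)) \<longlongrightarrow> (0::real)) (at_right 0)"
    by (rule filterlim_compose[OF tendsto_power_div_exp_0 filterlim_inverse_at_top_right])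
  moreover have "\<forall>\<^sub>F t in at_right 0. inverse t ^ m / exp (inverse t) = flat m t"
    by (auto simp: eventually_at_filter flat_def exp_minus field_simps)
  ultimately have "(flat m \<longlongrightarrow> 0) (at_right 0)" by (rule Lim_transform_eventually)
  moreover have "(flat m \<longlongrightarrow> 0) (at_left 0)"
    by (rule tendsto_eventually) (auto simp: eventually_at_filter flat_def)
  ultimately show ?thesis by (simp add: filterlim_split_at)
qed

lemma DERIV_flat:
  "(flat m has_real_derivative flat (m + 2) t - real m * flat (m + 1) t) (at t)"
proof -
  consider "t < 0" | "t = 0" | "0 < t" by linarith
  then show ?thesis
  proof cases
    case 1
    have "((\<lambda>t. 0) has_real_derivative flat (m + 2) t - real m * flat (m + 1) t) (at t)"
      using 1 by (simp add: flat_def)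
    moreover have "flat m s = 0" if "s \<in> {..<0}" for s using that by (simp add: flat_def)
    ultimately show ?thesis
      using 1 by (subst has_field_derivative_cong_ev[where g = "\<lambda>t. 0" and S = UNIV, OF refl])
        (auto intro!: eventually_nhds_in_open[of "{..<0}", THEN eventually_mono])
  next
    case 2
    have "flat (m + 1) = (\<lambda>s. flat m s / s)" by (rule ext) (simp add: flat_def)
    then have "((\<lambda>s. flat m s / s) \<longlongrightarrow> 0) (at 0)"
      using flat_tendsto_0[of "m + 1"] by (simp only:)
    then show ?thesis using 2 by (simp add: DERIV_def flat_def)
  next
    case 3
    have "((\<lambda>s. exp (- 1 / s) / s ^ m) has_real_derivative flat (m + 2) t - real m * flat (m + 1) t) (at t)"
    proof -
      have "((\<lambda>s. exp (- 1 / s) / s ^ m) has_real_derivative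
          (exp (- 1 / t) * (1 / t^2) * t ^ m - exp (- 1 / t) * (real m * t ^ (m - 1))) / (t ^ m * t ^ m)) (at t)"
        using 3 by (auto intro!: derivative_eq_intros simp: power2_eq_square)
      moreover have "(exp (- 1 / t) * (1 / t^2) * t ^ m - exp (- 1 / t) * (real m * t ^ (m - 1))) / (t ^ m * t ^ m)
          = flat (m + 2) t - real m * flat (m + 1) t"
        using 3 by (cases m) (simp_all add: flat_def field_simps power2_eq_square)
      ultimately show ?thesis by simp
    qed
    moreover have "\<forall>\<^sub>F s in nhds t. flat m s = exp (- 1 / s) / s ^ m"
      using 3 by (auto intro!: eventually_nhds_in_open[of "{0<..}", THEN eventually_mono] simp: flat_def)
    ultimately show ?thesis by (subst has_field_derivative_cong_ev[OF refl]) auto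
  qed
qed

text \<open>A class of functions on the plane that contains the test functions and the competitor below.
  It is generated so that partial derivatives stay in the class, and every function in such a class is smooth.\<close>

inductive_set elementary :: "(real \<times> real \<Rightarrow> real) set" where
  const: "(\<lambda>p. c) \<in> elementary"
| fst: "fst \<in> elementary"
| exp: "(\<lambda>p. exp (\<alpha> * snd p)) \<in> elementary"
| flat: "(\<lambda>p. flat m (\<alpha> * fst p + \<beta> * snd p + \<gamma>)) \<in> elementary"
| add: "f \<in> elementary \<Longrightarrow> g \<in> elementary \<Longrightarrow> (\<lambda>p. f p + g p) \<in> elementary"
| mult: "f \<in> elementary \<Longrightarrow> g \<in> elementary \<Longrightarrow> (\<lambda>p. f p * g p) \<in> elementary"

lemma elementary_has_derivative:
  "f \<in> elementary \<Longrightarrow>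
    \<exists>f'. (\<forall>p. (f has_derivative f' p) (at p)) \<and> (\<forall>v. (\<lambda>p. f' p v) \<in> elementary)"
proof (induction rule: elementary.induct)
  case (const c)
  show ?case by (rule exI[of _ "\<lambda>p v. 0"]) (auto intro: elementary.const)
next
  case fst
  show ?case by (rule exI[of _ "\<lambda>p v. fst v"]) (auto intro!: elementary.const has_derivative_fst has_derivative_ident)
next
  case (exp \<alpha>)
  have "(\<lambda>p. exp (\<alpha> * snd p) * (\<alpha> * snd v)) \<in> elementary" for v :: "real \<times> real"
    by (intro elementary.intros)
  then show ?case
    by (intro exI[of _ "\<lambda>p v. exp (\<alpha> * snd p) * (\<alpha> * snd v)"])
      (auto intro!: derivative_eq_intros)
next
  case (flat m \<alpha> \<beta> \<gamma>)
  let ?l = "\<lambda>p. \<alpha> * fst p + \<beta> * snd p + \<gamma>"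
  have d: "((\<lambda>p. flat m (?l p)) has_derivative
      (\<lambda>v. (flat (m + 2) (?l p) + (- real m) * flat (m + 1) (?l p)) * (\<alpha> * fst v + \<beta> * snd v))) (at p)" for p
  proof -
    have "(?l has_derivative (\<lambda>v. \<alpha> * fst v + \<beta> * snd v)) (at p)"
      by (auto intro!: derivative_eq_intros)
    from has_derivative_compose[OF this DERIV_flat[unfolded has_field_derivative_def]]
    show ?thesis by simp
  qed
  have "(\<lambda>p. (flat (m + 2) (?l p) + (- real m) * flat (m + 1) (?l p)) * (\<alpha> * fst v + \<beta> * snd v)) \<in> elementary" for v :: "real \<times> real"
    by (intro elementary.intros)
  with d show ?case
    by (intro exI[of _ "\<lambda>p v. (flat (m + 2) (?l p) + (- real m) * flat (m + 1) (?l p)) * (\<alpha> * fst v + \<beta> * snd v)"]) simp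
next
  case (add f g)
  then obtain f' g' where "\<And>p. (f has_derivative f' p) (at p)" "\<And>v. (\<lambda>p. f' p v) \<in> elementary"
    "\<And>p. (g has_derivative g' p) (at p)" "\<And>v. (\<lambda>p. g' p v) \<in> elementary" by blast
  then show ?case
    by (intro exI[of _ "\<lambda>p v. f' p v + g' p v"]) (auto intro: elementary.add has_derivative_add)
next
  case (mult f g)
  then obtain f' g' where *: "\<And>p. (f has_derivative f' p) (at p)" "\<And>v. (\<lambda>p. f' p v) \<in> elementary"
    "\<And>p. (g has_derivative g' p) (at p)" "\<And>v. (\<lambda>p. g' p v) \<in> elementary" by blast
  then have "(\<lambda>p. f p * g' p v + f' p v * g p) \<in> elementary" for v
    using mult by (intro elementary.add elementary.mult) auto
  with * show ?case
    by (intro exI[of _ "\<lambda>p v. f p * g' p v + f' p v * g p"]) (auto intro: has_derivative_mult)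
qed

lemma elementary_smooth:
  assumes "f \<in> elementary" shows "smooth f"
proof -
  have "Ck k f" for k using assms
  proof (induction k arbitrary: f)
    case 0
    then obtain f' where "\<And>p. (f has_derivative f' p) (at p)" using elementary_has_derivative by blast
    then have "isCont f p" for p by (rule has_derivative_continuous)
    then show ?case by (simp add: continuous_at_imp_continuous_on)
  next
    case (Suc k)
    then obtain f' where f': "\<And>p. (f has_derivative f' p) (at p)" "\<And>v. (\<lambda>p. f' p v) \<in> elementary"
      using elementary_has_derivative by blast
    then have "frechet_derivative f (at p) = f' p" for p by (metis frechet_derivative_at)
    with f' Suc.IH show ?case by (auto simp: differentiable_def)
  qed
  then show ?thesis by (simp add: smooth_def)
qed

text \<open>Each factor vanishes up to distance \<open>1/n\<close> from one side of the rectangle, so the support is compact in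
  the open rectangle. As \<open>n\<close> grows, each factor tends to 1 at every interior point, because its argument tends to
  infinity.\<close>

definition box_bump :: "real \<Rightarrow> real \<Rightarrow> real \<Rightarrow> real \<Rightarrow> nat \<Rightarrow> real \<times> real \<Rightarrow> real" where
  "box_bump a b c d n p =
     flat 0 (real n * (fst p - a) - 1) * flat 0 (real n * (b - fst p) - 1) *
     (flat 0 (real n * (snd p - c) - 1) * flat 0 (real n * (d - snd p) - 1))"

lemma flat_0_bounds: "0 \<le> flat 0 t" "flat 0 t \<le> 1"
  by (auto simp: flat_def)

lemma box_bump_bounds: "\<bar>box_bump a b c d n p\<bar> \<le> 1"
  unfolding box_bump_def abs_mult using flat_0_bounds by (intro mult_le_one) (auto intro!: mult_nonneg_nonneg)

lemma box_bump_test_function: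
  assumes "0 < n" "box (a,c) (b,d) \<subseteq> \<Omega>"
  shows "box_bump a b c d n \<in> test_functions \<Omega>"
proof -
  have "box_bump a b c d n = (\<lambda>p.
     flat 0 (real n * fst p + 0 * snd p + (- real n * a - 1)) * flat 0 ((- real n) * fst p + 0 * snd p + (real n * b - 1)) *
     (flat 0 (0 * fst p + real n * snd p + (- real n * c - 1)) * flat 0 (0 * fst p + (- real n) * snd p + (real n * d - 1))))"
    by (rule ext) (simp add: box_bump_def algebra_simps)
  also have "\<dots> \<in> elementary" by (intro elementary.intros)
  finally have "smooth (box_bump a b c d n)" by (rule elementary_smooth)
  moreover have "box_bump a b c d n p = 0" if "p \<notin> cbox (a + 1/n, c + 1/n) (b - 1/n, d - 1/n)" for p
  proof -
    obtain x y where p: "p = (x,y)" by (cases p)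
    consider "x < a + 1/n" | "b - 1/n < x" | "y < c + 1/n" | "d - 1/n < y"
      using \<open>p \<notin> _\<close> by (force simp: p cbox_Pair_eq not_le)
    then show ?thesis
      using \<open>0 < n\<close> by cases (auto simp: p box_bump_def flat_def field_simps)
  qed
  moreover have "cbox (a + 1/n, c + 1/n) (b - 1/n, d - 1/n) \<subseteq> \<Omega>"
  proof -
    define e where "e = 1 / real n"
    have "0 < e" using \<open>0 < n\<close> by (simp add: e_def)
    then have "cbox (a + 1/n, c + 1/n) (b - 1/n, d - 1/n) \<subseteq> box (a,c) (b,d)"
      unfolding e_def[symmetric] by (auto simp: box_pair cbox_Pair_eq)
    then show ?thesis using assms(2) by blast
  qed
  ultimately show ?thesis unfolding test_functions_def by (blast intro: compact_cbox)
qed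

lemma box_bump_tendsto: "(\<lambda>n. box_bump a b c d n p) \<longlonglongrightarrow> indicat_real (box (a,c) (b,d)) p"
proof -
  have *: "(\<lambda>n. flat 0 (real n * r - 1)) \<longlonglongrightarrow> (if 0 < r then 1 else 0)" for r
  proof (cases "0 < r")
    case True
    have inf: "filterlim (\<lambda>n. real n * r - 1) at_top sequentially"
    proof -
      have "filterlim (\<lambda>n. - 1 + real n * r) at_top sequentially"
        by (intro filterlim_tendsto_add_at_top[OF tendsto_const]
            filterlim_at_top_mult_tendsto_pos[OF tendsto_const True filterlim_real_sequentially])
      then show ?thesis by simp
    qed
    have "(\<lambda>n. exp (- 1 / (real n * r - 1))) \<longlonglongrightarrow> exp 0"
      by (intro tendsto_intros tendsto_divide_0[OF tendsto_const] filterlim_at_top_imp_at_infinity inf)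
    moreover have "\<forall>\<^sub>F n in sequentially. exp (- 1 / (real n * r - 1)) = flat 0 (real n * r - 1)"
      using filterlim_at_top_dense[THEN iffD1, OF inf, rule_format, of 0]
      by eventually_elim (simp add: flat_def)
    ultimately show ?thesis using True by (auto intro: Lim_transform_eventually)
  next
    case False
    then have "real n * r - 1 \<le> 0" for n :: nat
      using mult_nonneg_nonpos[of "real n" r] by simp
    then have "flat 0 (real n * r - 1) = 0" for n by (simp add: flat_def)
    then show ?thesis using False by simp
  qed
  have "(\<lambda>n. box_bump a b c d n p) \<longlonglongrightarrow>
     (if 0 < fst p - a then 1 else 0) * (if 0 < b - fst p then 1 else 0) *
     ((if 0 < snd p - c then 1 else 0) * (if 0 < d - snd p then 1 else 0))"
    unfolding box_bump_def by (intro tendsto_mult *)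
  moreover have "(if 0 < fst p - a then 1 else 0) * (if 0 < b - fst p then 1 else 0) *
     ((if 0 < snd p - c then 1 else 0) * (if 0 < d - snd p then 1 else 0)) = indicat_real (box (a,c) (b,d)) p"
    by (cases p) (simp add: box_pair indicator_def)
  ultimately show ?thesis by (simp only:)
qed

section \<open>Weak gradients of smooth functions on a rectangle\<close>

text \<open>Needed for the uniqueness of densities with respect to the completed measure.\<close>

lemma sigma_finite_lebesgue: "sigma_finite_measure (lebesgue :: 'a::euclidean_space measure)"
proof
  obtain A :: "'a set set" where A: "countable A" "A \<subseteq> sets lborel" "\<Union>A = space lborel"
    "\<forall>a\<in>A. emeasure lborel a \<noteq> \<infinity>"
    using lborel.sigma_finite_countable by blast
  have "\<forall>a\<in>A. emeasure lebesgue a \<noteq> \<infinity>"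
  proof
    fix a assume "a \<in> A"
    then have "a \<in> sets lborel" "emeasure lborel a \<noteq> \<infinity>" using A(2,4) by blast+
    then show "emeasure lebesgue a \<noteq> \<infinity>" by simp
  qed
  moreover have "A \<subseteq> sets lebesgue" "\<Union>A = space lebesgue" using A(2,3) by auto
  ultimately show "\<exists>A :: 'a set set. countable A \<and> A \<subseteq> sets lebesgue \<and> \<Union>A = space lebesgue \<and> (\<forall>a\<in>A. emeasure lebesgue a \<noteq> \<infinity>)"
    using A(1) by blast
qed

text \<open>Every Lebesgue measurable set differs from a Borel set by a null set.\<close>

lemma borel_set_integrals_zero_imp_AE_zero:
  fixes F :: "'a::euclidean_space \<Rightarrow> 'b::euclidean_space"
  assumes F: "integrable lebesgue F" and B: "\<And>A. A \<in> sets borel \<Longrightarrow> (LINT x:A|lebesgue. F x) = 0"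
  shows "AE x in lebesgue. F x = 0"
proof (rule sigma_finite_measure.density_zero[OF sigma_finite_lebesgue F])
  fix A :: "'a set" assume A: "A \<in> sets lebesgue"
  then obtain S N N' where S: "S \<in> sets lborel" "N' \<in> null_sets lborel" "N \<subseteq> N'" "A = S \<union> N"
    by (rule sets_completionE)
  have SL: "S \<in> sets lebesgue" using S(1) by simp
  have "N' \<in> null_sets lebesgue" using S(2) by (rule null_sets_completionI)
  then have "(A - S) \<union> (S - A) \<in> null_sets lebesgue"
  proof (rule null_sets_subset)
    show "(A - S) \<union> (S - A) \<in> sets lebesgue" using A SL by (intro sets.Un sets.Diff)
    show "(A - S) \<union> (S - A) \<subseteq> N'" using S by blast
  qed
  then have "(LINT x:A|lebesgue. F x) = (LINT x:S|lebesgue. F x)"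
    using A SL by (intro set_integral_null_delta[OF F])
  then show "(LINT x:A|lebesgue. F x) = 0" using B S(1) by simp
qed

text \<open>Open boxes are stable under intersection and generate the Borel sets, so Dynkin's
  theorem applies.\<close>

lemma box_set_integrals_zero_imp_AE_zero:
  fixes F :: "'a::euclidean_space \<Rightarrow> 'b::euclidean_space"
  assumes F: "integrable lebesgue F" and box: "\<And>a b. (LINT x:box a b|lebesgue. F x) = 0"
    and all: "(LINT x|lebesgue. F x) = 0"
  shows "AE x in lebesgue. F x = 0"
proof (rule borel_set_integrals_zero_imp_AE_zero[OF F])
  let ?G = "range (\<lambda>(a, b). box a b :: 'a set)"
  have int: "set_integrable lebesgue A F" if "A \<in> sets borel" for A
  proof -
    have "A \<in> sets lebesgue" using that by simp
    then show ?thesis using F unfolding set_integrable_def by (rule integrable_mult_indicator)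
  qed
  fix A :: "'a set" assume "A \<in> sets borel"
  then have A: "A \<in> sigma_sets UNIV ?G" by (simp add: borel_eq_box)
  have "Int_stable ?G" "?G \<subseteq> Pow UNIV" by (auto simp: Int_stable_def box_Int_box)
  from this A show "(LINT x:A|lebesgue. F x) = 0"
  proof (induction rule: sigma_sets_induct_disjoint)
    case (compl A)
    then have A: "A \<in> sets borel" by (simp add: borel_eq_box)
    have "(LINT x:UNIV|lebesgue. F x) = (LINT x:A \<union> (UNIV - A)|lebesgue. F x)" by simp
    also have "\<dots> = (LINT x:A|lebesgue. F x) + (LINT x:UNIV - A|lebesgue. F x)"
      using A by (intro set_integral_Un int) auto
    finally show ?case using compl.IH all by (simp add: set_lebesgue_integral_def)
  next
    case (union A)
    have A: "A i \<in> sets borel" for i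
      using union.hyps(2) by (simp add: borel_eq_box range_subsetD)
    have "(LINT x:(\<Union>i. A i)|lebesgue. F x) = (\<Sum>i. (LINT x:A i|lebesgue. F x))"
    proof (rule lebesgue_integral_countable_add)
      show "A i \<in> sets lebesgue" for i using A[of i] by simp
      show "A i \<inter> A j = {}" if "i \<noteq> j" for i j
        using union.hyps(1) that by (simp add: disjoint_family_on_def)
      show "set_integrable lebesgue (\<Union>i. A i) F" using A by (intro int) blast
    qed
    then show ?case using union.IH by simp
  next
    case empty
    show ?case by (simp add: set_lebesgue_integral_def)
  next
    case (basic A)
    then show ?case using box by auto
  qed
qed

text \<open>The bumps of a box contained in the rectangle are bounded by 1 and converge to its indicator function, so
  dominated convergence makes the integral of \<open>f\<close> over every such box vanish. The intersection of an
  arbitrary box with the rectangle is again a box.\<close>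

lemma fundamental_lemma_box:
  fixes f :: "real \<times> real \<Rightarrow> real \<times> real"
  assumes f: "set_integrable lebesgue (box (a,c) (b,d)) f"
    and test: "\<And>\<phi>. \<phi> \<in> test_functions (box (a,c) (b,d)) \<Longrightarrow> (LINT x:box (a,c) (b,d)|lebesgue. \<phi> x *\<^sub>R f x) = 0"
  shows "AE x in lebesgue. x \<in> box (a,c) (b,d) \<longrightarrow> f x = 0"
proof -
  let ?\<Omega> = "box (a,c) (b,d)"
  define F where "F x = indicat_real ?\<Omega> x *\<^sub>R f x" for x
  have F: "integrable lebesgue F" using f by (simp add: F_def[abs_def] set_integrable_def)
  have sub: "(LINT x:box (a',c') (b',d')|lebesgue. F x) = 0" if "box (a',c') (b',d') \<subseteq> ?\<Omega>" for a' b' c' d'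
  proof -
    let ?Q = "box (a',c') (b',d')" and ?\<phi> = "\<lambda>n. box_bump a' b' c' d' (Suc n)"
    have "(LINT x|lebesgue. ?\<phi> n x *\<^sub>R F x) = 0" for n
      using test[OF box_bump_test_function[OF _ that, of "Suc n"]]
      by (simp add: F_def set_lebesgue_integral_def mult.commute)
    moreover have "(\<lambda>n. LINT x|lebesgue. ?\<phi> n x *\<^sub>R F x) \<longlonglongrightarrow> (LINT x|lebesgue. indicat_real ?Q x *\<^sub>R F x)"
    proof (rule integral_dominated_convergence[where w = "\<lambda>x. norm (F x)"])
      show "integrable lebesgue (\<lambda>x. norm (F x))" using F by (rule integrable_norm)
      show "AE x in lebesgue. (\<lambda>n. ?\<phi> n x *\<^sub>R F x) \<longlonglongrightarrow> indicat_real ?Q x *\<^sub>R F x"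
        by (intro AE_I2 tendsto_scaleR tendsto_const LIMSEQ_Suc box_bump_tendsto)
      show "AE x in lebesgue. norm (?\<phi> n x *\<^sub>R F x) \<le> norm (F x)" for n
        using box_bump_bounds by (intro AE_I2) (simp add: mult_left_le_one_le)
      show "(\<lambda>x. indicat_real ?Q x *\<^sub>R F x) \<in> borel_measurable lebesgue"
        using F by (intro borel_measurable_scaleR borel_measurable_indicator borel_measurable_integrable) auto
      have "smooth (?\<phi> n)" for n
        using box_bump_test_function[OF _ that, of "Suc n"] by (simp add: test_functions_def)
      then have "continuous_on UNIV (?\<phi> n)" for n by (rule smooth_continuous)
      then have "?\<phi> n \<in> borel_measurable lebesgue" for n
        by (intro measurable_completion) (simp add: borel_measurable_continuous_onI)
      then show "(\<lambda>x. ?\<phi> n x *\<^sub>R F x) \<in> borel_measurable lebesgue" for n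
        by (intro borel_measurable_scaleR borel_measurable_integrable[OF F])
    qed
    ultimately have "(LINT x|lebesgue. indicat_real ?Q x *\<^sub>R F x) = 0"
      by (simp add: LIMSEQ_const_iff)
    then show ?thesis by (simp add: set_lebesgue_integral_def)
  qed
  have "AE x in lebesgue. F x = 0"
  proof (rule box_set_integrals_zero_imp_AE_zero[OF F])
    fix l r :: "real \<times> real"
    obtain l1 l2 r1 r2 where lr: "l = (l1,l2)" "r = (r1,r2)" by (cases l, cases r)
    have Q: "box (max a l1, max c l2) (min b r1, min d r2) = box l r \<inter> ?\<Omega>"
      unfolding lr box_pair by auto
    have "(LINT x:box l r|lebesgue. F x) = (LINT x:box l r \<inter> ?\<Omega>|lebesgue. F x)"
      unfolding set_lebesgue_integral_def
      by (intro Bochner_Integration.integral_cong) (auto simp: F_def indicator_def)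
    also have "\<dots> = 0" unfolding Q[symmetric] by (rule sub) (auto simp: Q)
    finally show "(LINT x:box l r|lebesgue. F x) = 0" .
  next
    have "(LINT x|lebesgue. F x) = (LINT x:?\<Omega>|lebesgue. F x)"
      unfolding set_lebesgue_integral_def
      by (intro Bochner_Integration.integral_cong) (auto simp: F_def indicator_def)
    then show "(LINT x|lebesgue. F x) = 0" using sub by simp
  qed
  then show ?thesis by eventually_elim (auto simp: F_def indicator_def)
qed

lemma set_integrable_box_continuous:
  fixes f :: "'a::euclidean_space \<Rightarrow> 'b::euclidean_space"
  assumes "continuous_on UNIV f"
  shows "set_integrable lebesgue (box a b) f"
proof -
  have "f absolutely_integrable_on cbox a b"
    using assms by (intro absolutely_integrable_continuous) (rule continuous_on_subset, auto)
  then show ?thesis by (rule set_integrable_subset) (auto simp: box_subset_cbox)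
qed

lemma continuous_in_L2_box:
  fixes f :: "'a::euclidean_space \<Rightarrow> 'b::euclidean_space"
  assumes "continuous_on UNIV f"
  shows "f \<in> L2 (box a b)"
proof -
  have "set_integrable lebesgue (box a b) (\<lambda>x. (norm (f x))\<^sup>2)"
    by (intro set_integrable_box_continuous continuous_intros assms)
  then have "(\<integral>\<^sup>+x. ennreal (norm (indicat_real (box a b) x *\<^sub>R (norm (f x))\<^sup>2)) \<partial>lebesgue) < \<infinity>"
    unfolding set_integrable_def integrable_iff_bounded by blast
  moreover have "ennreal (norm (indicat_real (box a b) x *\<^sub>R (norm (f x))\<^sup>2))
      = ennreal ((norm (f x))\<^sup>2) * indicator (box a b) x" for x
    by (simp add: indicator_def)
  moreover have "f \<in> borel_measurable (lebesgue_on (box a b))"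
    using assms by (intro continuous_imp_measurable_on_sets_lebesgue) (auto intro: continuous_on_subset)
  ultimately show ?thesis by (simp add: L2_def)
qed

text \<open>The integrand is the gradient of \<open>u * \<phi>\<close>, which vanishes on the boundary of the rectangle.\<close>

lemma integral_gradient_product_zero:
  fixes u \<phi> :: "real \<times> real \<Rightarrow> real"
  assumes u: "smooth u" and \<phi>: "\<phi> \<in> test_functions (box (a,c) (b,d))" and "a \<le> b" "c \<le> d"
  shows "integral (cbox (a,c) (b,d)) (\<lambda>p. u p *\<^sub>R gradient \<phi> p + \<phi> p *\<^sub>R gradient u p) = 0"
proof -
  let ?R = "cbox (a,c) (b,d)"
  define W where "W p = u p *\<^sub>R gradient \<phi> p + \<phi> p *\<^sub>R gradient u p" for p
  have s\<phi>: "smooth \<phi>" and zero: "\<And>p. p \<notin> box (a,c) (b,d) \<Longrightarrow> \<phi> p = 0"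
    using \<phi> by (auto simp: test_functions_def)
  have cont: "continuous_on ?R W"
    unfolding W_def by (intro continuous_intros smooth_continuous smooth_continuous_gradient u s\<phi>)
  have int: "W integrable_on ?R" by (rule integrable_continuous[OF cont])
  have "integral ?R (fst \<circ> W) = integral {c..d} (\<lambda>y. u (b,y) * \<phi> (b,y) - u (a,y) * \<phi> (a,y))"
  proof (rule integral_rectangle_partial_fst[OF \<open>a \<le> b\<close>, where w = "\<lambda>p. u p * \<phi> p"])
    show "continuous_on ?R (fst \<circ> W)" using cont by (intro continuous_on_compose) (auto intro: continuous_intros)
    show "((\<lambda>x. u (x,y) * \<phi> (x,y)) has_real_derivative (fst \<circ> W) (x,y)) (at x)" for x y
      by (auto intro!: derivative_eq_intros smooth_partial_fst u s\<phi> simp: W_def algebra_simps)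
  qed
  also have "\<dots> = 0" using zero by (simp add: box_pair)
  finally have 1: "integral ?R (fst \<circ> W) = 0" .
  have "integral ?R (snd \<circ> W) = integral {a..b} (\<lambda>x. u (x,d) * \<phi> (x,d) - u (x,c) * \<phi> (x,c))"
  proof (rule integral_rectangle_partial_snd[OF \<open>c \<le> d\<close>, where w = "\<lambda>p. u p * \<phi> p"])
    show "continuous_on ?R (snd \<circ> W)" using cont by (intro continuous_on_compose) (auto intro: continuous_intros)
    show "((\<lambda>y. u (x,y) * \<phi> (x,y)) has_real_derivative (snd \<circ> W) (x,y)) (at y)" for x y
      by (auto intro!: derivative_eq_intros smooth_partial_snd u s\<phi> simp: W_def algebra_simps)
  qed
  also have "\<dots> = 0" using zero by (simp add: box_pair)
  finally have 2: "integral ?R (snd \<circ> W) = 0" .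
  have "integral ?R W = 0"
    using 1 2 integral_linear[OF int bounded_linear_fst] integral_linear[OF int bounded_linear_snd]
    by (simp add: prod_eq_iff)
  then show ?thesis by (simp add: W_def[abs_def])
qed

lemma smooth_is_weak_gradient_box:
  fixes u :: "real \<times> real \<Rightarrow> real"
  assumes u: "smooth u" and "a \<le> b" "c \<le> d"
  shows "is_weak_gradient (box (a,c) (b,d)) u (gradient u)"
  unfolding is_weak_gradient_def
proof
  fix \<phi> assume \<phi>: "\<phi> \<in> test_functions (box (a,c) (b,d))"
  let ?\<Omega> = "box (a,c) (b,d)"
  have s\<phi>: "smooth \<phi>" using \<phi> by (auto simp: test_functions_def)
  have i1: "set_integrable lebesgue ?\<Omega> (\<lambda>p. u p *\<^sub>R gradient \<phi> p)"
    and i2: "set_integrable lebesgue ?\<Omega> (\<lambda>p. \<phi> p *\<^sub>R gradient u p)"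
    by (intro set_integrable_box_continuous continuous_intros smooth_continuous smooth_continuous_gradient u s\<phi>)+
  have "(LINT p:?\<Omega>|lebesgue. u p *\<^sub>R gradient \<phi> p) + (LINT p:?\<Omega>|lebesgue. \<phi> p *\<^sub>R gradient u p)
      = (LINT p:?\<Omega>|lebesgue. u p *\<^sub>R gradient \<phi> p + \<phi> p *\<^sub>R gradient u p)"
    by (rule set_integral_add(2)[OF i1 i2, symmetric])
  also have "\<dots> = integral ?\<Omega> (\<lambda>p. u p *\<^sub>R gradient \<phi> p + \<phi> p *\<^sub>R gradient u p)"
    by (rule set_lebesgue_integral_eq_integral(2)[OF set_integral_add(1)[OF i1 i2]])
  also have "\<dots> = 0"
    using integral_gradient_product_zero[OF u \<phi> assms(2,3)] by (simp add: integral_open_interval)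
  finally show "(LINT p:?\<Omega>|lebesgue. u p *\<^sub>R gradient \<phi> p) = - (LINT p:?\<Omega>|lebesgue. \<phi> p *\<^sub>R gradient u p)"
    by (simp add: eq_neg_iff_add_eq_0)
qed

text \<open>A box has finite measure, and \<open>norm (G x) \<le> 1 + (norm (G x))\<^sup>2\<close>.\<close>

lemma L2_box_set_integrable:
  fixes G :: "'a::euclidean_space \<Rightarrow> 'b::euclidean_space"
  assumes "G \<in> L2 (box a b)"
  shows "set_integrable lebesgue (box a b) G"
proof -
  let ?\<Omega> = "box a b"
  have m: "G \<in> borel_measurable (lebesgue_on ?\<Omega>)"
    and fin: "(\<integral>\<^sup>+x\<in>?\<Omega>. ennreal ((norm (G x))\<^sup>2) \<partial>lebesgue) < \<infinity>"
    using assms by (auto simp: L2_def)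
  have "(\<integral>\<^sup>+x. ennreal (norm (G x)) \<partial>lebesgue_on ?\<Omega>) \<le> (\<integral>\<^sup>+x. 1 + ennreal ((norm (G x))\<^sup>2) \<partial>lebesgue_on ?\<Omega>)"
  proof (rule nn_integral_mono)
    fix x
    have "0 \<le> (norm (G x) - 1/2)\<^sup>2" by simp
    then have "norm (G x) \<le> 1 + (norm (G x))\<^sup>2" by (simp add: power2_diff power_divide)
    then have "ennreal (norm (G x)) \<le> ennreal (1 + (norm (G x))\<^sup>2)" by (rule ennreal_leI)
    then show "ennreal (norm (G x)) \<le> 1 + ennreal ((norm (G x))\<^sup>2)" by simp
  qed
  also have "\<dots> = emeasure lebesgue ?\<Omega> + (\<integral>\<^sup>+x\<in>?\<Omega>. ennreal ((norm (G x))\<^sup>2) \<partial>lebesgue)"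
    using m by (simp add: nn_integral_add emeasure_restrict_space nn_integral_restrict_space)
  also have "\<dots> < \<infinity>"
    using fin emeasure_lborel_box_finite[of a b] by (simp add: less_top[symmetric])
  finally have "integrable (lebesgue_on ?\<Omega>) G" using m by (simp add: integrable_iff_bounded)
  then show ?thesis by (simp add: set_integrable_def integrable_restrict_space)
qed

text \<open>The chosen weak gradient and the classical gradient have the same integral against every test
  function, so the fundamental lemma applies to their difference.\<close>

lemma weak_gradient_smooth_box:
  fixes u :: "real \<times> real \<Rightarrow> real"
  assumes u: "smooth u" and "a \<le> b" "c \<le> d"
  shows "AE p in lebesgue. p \<in> box (a,c) (b,d) \<longrightarrow> weak_gradient (box (a,c) (b,d)) u p = gradient u p"
proof -
  let ?\<Omega> = "box (a,c) (b,d)"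
  define G where "G = weak_gradient ?\<Omega> u"
  have gL: "gradient u \<in> L2 ?\<Omega>" by (intro continuous_in_L2_box smooth_continuous_gradient u)
  have gw: "is_weak_gradient ?\<Omega> u (gradient u)" by (rule smooth_is_weak_gradient_box[OF assms])
  have G: "G \<in> L2 ?\<Omega>" "is_weak_gradient ?\<Omega> u G"
    using someI[of "\<lambda>G. G \<in> L2 ?\<Omega> \<and> is_weak_gradient ?\<Omega> u G", OF conjI[OF gL gw]]
    by (auto simp: G_def weak_gradient_def)
  have "AE p in lebesgue. p \<in> ?\<Omega> \<longrightarrow> G p - gradient u p = 0"
  proof (rule fundamental_lemma_box)
    show "set_integrable lebesgue ?\<Omega> (\<lambda>p. G p - gradient u p)"
      by (intro set_integral_diff(1) L2_box_set_integrable G gL)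
    fix \<phi> assume \<phi>: "\<phi> \<in> test_functions ?\<Omega>"
    have c\<phi>: "continuous_on S \<phi>" for S using \<phi> by (auto simp: test_functions_def intro: smooth_continuous)
    have "compact (\<phi> ` cbox (a,c) (b,d))" by (intro compact_continuous_image c\<phi> compact_cbox)
    then obtain B where B: "\<And>p. p \<in> ?\<Omega> \<Longrightarrow> \<bar>\<phi> p\<bar> \<le> B"
      using box_subset_cbox by (force dest!: compact_imp_bounded simp: bounded_iff)
    have int: "set_integrable lebesgue ?\<Omega> (\<lambda>p. \<phi> p *\<^sub>R H p)" if "H \<in> L2 ?\<Omega>" for H :: "real \<times> real \<Rightarrow> real \<times> real"
    proof -
      have \<phi>m: "\<phi> \<in> borel_measurable lebesgue"
        using c\<phi> by (intro measurable_completion) (simp add: borel_measurable_continuous_onI)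
      have H: "integrable lebesgue (\<lambda>p. indicat_real ?\<Omega> p *\<^sub>R H p)"
        using L2_box_set_integrable[OF that] by (simp add: set_integrable_def)
      have m: "(\<lambda>p. \<phi> p *\<^sub>R (indicat_real ?\<Omega> p *\<^sub>R H p)) \<in> borel_measurable lebesgue"
        by (rule borel_measurable_scaleR[OF \<phi>m borel_measurable_integrable[OF H]])
      have "integrable lebesgue (\<lambda>p. \<phi> p *\<^sub>R (indicat_real ?\<Omega> p *\<^sub>R H p))"
      proof (rule Bochner_Integration.integrable_bound[OF integrable_scaleR_right[OF H, of B] m])
        have "norm (\<phi> p *\<^sub>R (indicat_real ?\<Omega> p *\<^sub>R H p)) \<le> norm (B *\<^sub>R (indicat_real ?\<Omega> p *\<^sub>R H p))" for p
          using B[of p] by (auto simp: indicator_def intro!: mult_right_mono)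
        then show "AE p in lebesgue. norm (\<phi> p *\<^sub>R (indicat_real ?\<Omega> p *\<^sub>R H p)) \<le> norm (B *\<^sub>R (indicat_real ?\<Omega> p *\<^sub>R H p))"
          by simp
      qed
      then show ?thesis by (simp add: set_integrable_def mult.commute)
    qed
    have "(LINT p:?\<Omega>|lebesgue. \<phi> p *\<^sub>R (G p - gradient u p))
      = (LINT p:?\<Omega>|lebesgue. \<phi> p *\<^sub>R G p) - (LINT p:?\<Omega>|lebesgue. \<phi> p *\<^sub>R gradient u p)"
      using set_integral_diff(2)[OF int[OF G(1)] int[OF gL]] by (simp add: scaleR_diff_right)
    also have "\<dots> = 0"
    proof -
      have "(LINT p:?\<Omega>|lebesgue. u p *\<^sub>R gradient \<phi> p) = - (LINT p:?\<Omega>|lebesgue. \<phi> p *\<^sub>R G p)"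
        using G(2) \<phi> unfolding is_weak_gradient_def by (rule bspec)
      moreover have "(LINT p:?\<Omega>|lebesgue. u p *\<^sub>R gradient \<phi> p) = - (LINT p:?\<Omega>|lebesgue. \<phi> p *\<^sub>R gradient u p)"
        using gw \<phi> unfolding is_weak_gradient_def by (rule bspec)
      ultimately show ?thesis by simp
    qed
    finally show "(LINT p:?\<Omega>|lebesgue. \<phi> p *\<^sub>R (G p - gradient u p)) = 0" .
  qed
  then show ?thesis by eventually_elim (simp add: G_def)
qed

section \<open>The competitor\<close>

definition plateau :: "real \<Rightarrow> real \<Rightarrow> real \<Rightarrow> real" where
  "plateau L \<eta> x = (if 0 < x \<and> x < L then \<eta> else 0)"

text \<open>The strain decays over a height comparable to the width \<open>L\<close> of the island.\<close>

definition decaying_strain :: "real \<Rightarrow> real \<times> real \<Rightarrow> real" where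
  "decaying_strain L p = fst p * exp (- snd p / L)"

lemma subgraph_plateau: "0 < \<eta> \<Longrightarrow> subgraph (plateau L \<eta>) = box (0,0) (L,\<eta>)"
  by (rule set_eqI, rename_tac p, case_tac p) (simp add: subgraph_def plateau_def box_pair, linarith)

lemma smooth_decaying_strain: "smooth (decaying_strain L)"
proof -
  have "(\<lambda>p. fst p * exp ((- 1 / L) * snd p)) \<in> elementary"
    by (intro elementary.mult elementary.fst elementary.exp)
  moreover have "(\<lambda>p. fst p * exp ((- 1 / L) * snd p)) = decaying_strain L"
    by (rule ext) (simp add: decaying_strain_def)
  ultimately show ?thesis using elementary_smooth by metis
qed

lemma gradient_decaying_strain:
  assumes "L \<noteq> 0"
  shows "gradient (decaying_strain L) (x,y) = (exp (- y / L), - x / L * exp (- y / L))"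
proof -
  have "((\<lambda>x. decaying_strain L (x,y)) has_real_derivative exp (- y / L)) (at x)"
    unfolding decaying_strain_def by (auto intro!: derivative_eq_intros)
  moreover have "((\<lambda>y. decaying_strain L (x,y)) has_real_derivative - x / L * exp (- y / L)) (at y)"
    unfolding decaying_strain_def using assms by (auto intro!: derivative_eq_intros)
  ultimately show ?thesis
    using smooth_partial_fst[OF smooth_decaying_strain] smooth_partial_snd[OF smooth_decaying_strain]
    by (metis DERIV_unique prod.collapse)
qed

text \<open>On the rectangle the energy density is at most \<open>2 * exp (- 2 * y / L)\<close>. The integral of this bound is
  \<open>L\<^sup>2 * (1 - exp (- 2 * \<eta> / L))\<close>.\<close>

lemma decaying_strain_energy:
  assumes "0 < L" "0 < \<eta>"
  shows "(\<integral>\<^sup>+p\<in>box (0,0) (L,\<eta>). ennreal ((norm (gradient (decaying_strain L) p))\<^sup>2) \<partial>lebesgue)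
    \<le> ennreal (min (2 * (L * \<eta>)) (L^2))"
proof -
  let ?R = "box (0,0) (L,\<eta>)" and ?k = "\<lambda>p::real \<times> real. 2 * exp (- 2 * snd p / L)"
  have ck: "continuous_on S ?k" for S by (intro continuous_intros) (use \<open>0 < L\<close> in auto)
  have int: "set_integrable lebesgue ?R ?k" by (rule set_integrable_box_continuous[OF ck])
  have "(norm (gradient (decaying_strain L) p))\<^sup>2 \<le> ?k p" if "p \<in> ?R" for p
  proof -
    obtain x y where p: "p = (x,y)" "0 < x" "x < L" using \<open>p \<in> ?R\<close> by (cases p) (auto simp: box_pair)
    have norm2: "(norm (v, w))\<^sup>2 = v\<^sup>2 + w\<^sup>2" for v w :: real by (simp add: norm_Pair)
    have "(norm (gradient (decaying_strain L) p))\<^sup>2 = (exp (- y / L))\<^sup>2 + (- x / L * exp (- y / L))\<^sup>2"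
      using \<open>0 < L\<close> by (simp only: p(1) gradient_decaying_strain norm2 less_imp_neq[symmetric] not_False_eq_True)
    also have "\<dots> = (1 + (x / L)\<^sup>2) * (exp (- y / L))\<^sup>2"
      by (simp add: power_mult_distrib power_divide distrib_right)
    also have "(exp (- y / L))\<^sup>2 = exp (- 2 * y / L)" by (simp flip: exp_double)
    also have "(x / L)\<^sup>2 \<le> 1" using p \<open>0 < L\<close> by (simp add: power_le_one)
    finally show ?thesis by (simp add: p(1) mult_right_mono)
  qed
  then have "(\<integral>\<^sup>+p\<in>?R. ennreal ((norm (gradient (decaying_strain L) p))\<^sup>2) \<partial>lebesgue)
    \<le> (\<integral>\<^sup>+p. ennreal (indicat_real ?R p *\<^sub>R ?k p) \<partial>lebesgue)"
    by (intro nn_integral_mono) (auto simp: indicator_def intro!: ennreal_leI)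
  also have "\<dots> = ennreal (LINT p:?R|lebesgue. ?k p)"
    unfolding set_lebesgue_integral_def
    by (rule nn_integral_eq_integral[OF int[unfolded set_integrable_def]]) (auto simp: indicator_def)
  also have "(LINT p:?R|lebesgue. ?k p) = integral (cbox (0,0) (L,\<eta>)) ?k"
    using set_lebesgue_integral_eq_integral(2)[OF int] by (simp add: integral_open_interval)
  also have "\<dots> = integral {0..L} (\<lambda>x. (- L * exp (- 2 * snd (x,\<eta>) / L)) - (- L * exp (- 2 * snd (x,0::real) / L)))"
    by (rule integral_rectangle_partial_snd[where w = "\<lambda>p. - L * exp (- 2 * snd p / L)"])
      (use assms ck in \<open>auto intro!: derivative_eq_intros\<close>)
  also have "\<dots> = L * (L * (1 - exp (- 2 * \<eta> / L)))"
    using \<open>0 < L\<close> by (simp add: algebra_simps)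
  also have "\<dots> \<le> min (2 * (L * \<eta>)) (L^2)"
  proof -
    have "1 - exp (- 2 * \<eta> / L) \<le> 2 * \<eta> / L" using exp_ge_add_one_self[of "- 2 * \<eta> / L"] by simp
    then have "L * (L * (1 - exp (- 2 * \<eta> / L))) \<le> L * (L * (2 * \<eta> / L))"
      using \<open>0 < L\<close> by (intro mult_left_mono) auto
    moreover have "L * (L * (1 - exp (- 2 * \<eta> / L))) \<le> L * (L * 1)"
      using \<open>0 < L\<close> by (intro mult_left_mono) auto
    ultimately show ?thesis using \<open>0 < L\<close> by (simp add: power2_eq_square)
  qed
  finally show ?thesis by (simp add: ennreal_leI)
qed

text \<open>A plateau is the difference of two monotone functions, each with total increase \<open>\<eta>\<close>.\<close>

lemma pointwise_variation_plateau:
  assumes "0 < L" "0 \<le> \<eta>"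
  shows "pointwise_variation (plateau L \<eta>) \<le> ennreal (2 * \<eta>)"
  unfolding pointwise_variation_def
proof (rule SUP_least, clarify)
  fix n and x :: "nat \<Rightarrow> real" assume x: "strict_mono_on {..n} x"
  define up where "up t = (if 0 < t then \<eta> else 0)" for t :: real
  define down where "down t = (if L \<le> t then \<eta> else 0)" for t :: real
  have eq: "plateau L \<eta> t = up t - down t" for t using assms by (auto simp: plateau_def up_def down_def)
  have "\<bar>plateau L \<eta> (x i) - plateau L \<eta> (x (i - 1))\<bar> \<le> (up (x i) + down (x i)) - (up (x (i - 1)) + down (x (i - 1)))"
    if "i \<in> {1..n}" for i
  proof -
    have "x (i - 1) < x i" using that by (intro strict_mono_onD[OF x]) auto
    then have "up (x (i - 1)) \<le> up (x i)" "down (x (i - 1)) \<le> down (x i)"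
      using assms by (auto simp: up_def down_def)
    then show ?thesis by (simp add: eq abs_le_iff)
  qed
  then have "(\<Sum>i=1..n. \<bar>plateau L \<eta> (x i) - plateau L \<eta> (x (i - 1))\<bar>)
    \<le> (\<Sum>i=1..n. (up (x i) + down (x i)) - (up (x (i - 1)) + down (x (i - 1))))"
    by (rule sum_mono)
  also have "\<dots> = (up (x n) + down (x n)) - (up (x 0) + down (x 0))"
    by (induction n) simp_all
  also have "\<dots> \<le> 2 * \<eta>" using assms by (auto simp: up_def down_def)
  finally show "ennreal (\<Sum>i=1..n. \<bar>plateau L \<eta> (x i) - plateau L \<eta> (x (i - 1))\<bar>) \<le> ennreal (2 * \<eta>)"
    by (rule ennreal_leI)
qed

lemma lower_semicontinuous_plateau:
  assumes "0 \<le> \<eta>" shows "lower_semicontinuous (plateau L \<eta>)"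
  unfolding lower_semicontinuous_def
proof (intro allI impI)
  fix x a assume a: "a < plateau L \<eta> x"
  show "\<forall>\<^sub>F y in nhds x. a < plateau L \<eta> y"
  proof (cases "a < 0")
    case True
    have "0 \<le> plateau L \<eta> y" for y using assms by (simp add: plateau_def)
    then have "a < plateau L \<eta> y" for y using True by (rule less_le_trans[rotated])
    then show ?thesis by simp
  next
    case False
    then have "x \<in> {0<..<L}" using a by (auto simp: plateau_def split: if_splits)
    then have "\<forall>\<^sub>F y in nhds x. y \<in> {0<..<L}" by (intro eventually_nhds_in_open) auto
    then show ?thesis
      by eventually_elim (use a \<open>x \<in> {0<..<L}\<close> in \<open>auto simp: plateau_def\<close>)
  qed
qed

lemma integral_plateau_times:
  "(LINT x|lebesgue. plateau L \<eta> x * f x) = \<eta> * (LINT x:{0<..<L}|lebesgue. f x)"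
proof -
  have "(LINT x|lebesgue. plateau L \<eta> x * f x) = (LINT x|lebesgue. \<eta> * (indicat_real {0<..<L} x *\<^sub>R f x))"
    by (intro Bochner_Integration.integral_cong) (auto simp: plateau_def indicator_def)
  then show ?thesis by (simp add: set_lebesgue_integral_def)
qed

lemma smooth_DERIV_deriv:
  fixes f :: "real \<Rightarrow> real"
  assumes "smooth f"
  shows "(f has_real_derivative deriv f x) (at x)" "continuous_on UNIV (deriv f)"
proof -
  have d: "(f has_real_derivative frechet_derivative f (at x) 1) (at x)" for x
  proof -
    define D where "D = frechet_derivative f (at x)"
    have D: "(f has_derivative D) (at x)" unfolding D_def by (rule smooth_has_derivative[OF assms])
    have "D h = D 1 * h" for h
      using linear_scale[OF has_derivative_linear[OF D], of h 1] by (simp add: mult.commute)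
    then have "D = (*) (D 1)" by (rule ext)
    then have "(f has_derivative (*) (D 1)) (at x)"
      by (rule back_subst[of "\<lambda>X. (f has_derivative X) (at x)", OF D])
    then show ?thesis by (simp only: has_field_derivative_def D_def)
  qed
  then have eq: "deriv f = (\<lambda>x. frechet_derivative f (at x) 1)" by (intro ext DERIV_imp_deriv)
  show "(f has_real_derivative deriv f x) (at x)" using d by (simp add: eq)
  show "continuous_on UNIV (deriv f)" unfolding eq by (rule smooth_continuous_partial[OF assms])
qed

lemma integrable_plateau: "integrable lebesgue (plateau L \<eta>)"
proof -
  have "emeasure lborel {0<..<L} < \<infinity>" using emeasure_lborel_box_finite[of 0 L] by simp
  then have "integrable lebesgue (\<lambda>x. \<eta> * indicat_real {0<..<L} x)"
    by (intro integrable_mult_right integrable_real_indicator) auto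
  moreover have "(\<lambda>x. \<eta> * indicat_real {0<..<L} x) = plateau L \<eta>"
    by (auto simp: plateau_def indicator_def)
  ultimately show ?thesis by simp
qed

lemma plateau_in_BV:
  assumes "0 < L" "0 \<le> \<eta>" shows "plateau L \<eta> \<in> BV"
proof -
  have "(LINT x|lebesgue. plateau L \<eta> x * deriv \<phi> x) \<le> 2 * \<eta>"
    if "\<phi> \<in> test_functions UNIV" "\<forall>x. \<bar>\<phi> x\<bar> \<le> 1" for \<phi>
  proof -
    have s: "smooth \<phi>" using \<open>\<phi> \<in> _\<close> by (simp add: test_functions_def)
    have "(LINT x:{0<..<L}|lebesgue. deriv \<phi> x) = integral {0<..<L} (deriv \<phi>)"
      using set_integrable_box_continuous[OF smooth_DERIV_deriv(2)[OF s], of 0 L]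
      by (intro set_lebesgue_integral_eq_integral(2)) simp
    also have "\<dots> = integral {0..L} (deriv \<phi>)" by (rule integral_open_interval_real[symmetric])
    also have "\<dots> = \<phi> L - \<phi> 0"
      using \<open>0 < L\<close> smooth_DERIV_deriv(1)[OF s]
      by (intro integral_unique fundamental_theorem_of_calculus)
        (auto simp: has_real_derivative_iff_has_vector_derivative[symmetric] intro: has_field_derivative_at_within)
    also have "\<dots> \<le> 2"
    proof -
      have "\<bar>\<phi> L\<bar> \<le> 1" "\<bar>\<phi> 0\<bar> \<le> 1" using \<open>\<forall>x. \<bar>\<phi> x\<bar> \<le> 1\<close> by blast+
      then show ?thesis by linarith
    qed
    finally show ?thesis
      using mult_left_mono[OF _ assms(2), of "LINT x:{0<..<L}|lebesgue. deriv \<phi> x" 2] unfolding integral_plateau_times by simp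
  qed
  then show ?thesis
    unfolding BV_def using integrable_plateau by (auto intro!: bdd_aboveI[of _ "2 * \<eta>"])
qed

text \<open>The displacement is smooth on the whole plane, so the constant sequence \<open>v n = u\<close> witnesses the
  trace. This requires the weak gradient to agree with the classical one.\<close>

lemma competitor_admissible:
  assumes "0 < L" "0 < \<eta>"
  shows "(decaying_strain L, plateau L \<eta>) \<in> admissible (L * \<eta>)"
proof -
  let ?u = "decaying_strain L" and ?\<Omega> = "box (0,0) (L,\<eta>)"
  have s: "smooth ?u" by (rule smooth_decaying_strain)
  have vol: "(LINT x|lebesgue. plateau L \<eta> x) = L * \<eta>"
    using integral_plateau_times[of L \<eta> "\<lambda>x. 1"] assms by (simp add: set_lebesgue_integral_def)
  have H1: "?u \<in> H1 ?\<Omega>"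
    using assms continuous_in_L2_box[OF smooth_continuous[OF s]] continuous_in_L2_box[OF smooth_continuous_gradient[OF s]]
      smooth_is_weak_gradient_box[OF s, of 0 L 0 \<eta>] by (auto simp: H1_def)
  have "is_bottom_trace ?\<Omega> ?u (\<lambda>x. x)"
    unfolding is_bottom_trace_def
  proof (intro conjI allI impI)
    show "(\<lambda>x::real. x) \<in> borel_measurable lebesgue" by (intro measurable_completion) simp
    fix a b t :: real assume R: "a < b \<and> 0 < t \<and> {a<..<b} \<times> {0<..<t} \<subseteq> ?\<Omega>"
    have "AE p in lebesgue. ennreal ((?u p - ?u p)\<^sup>2 + (norm (gradient ?u p - weak_gradient ?\<Omega> ?u p))\<^sup>2)
        * indicator ({a<..<b} \<times> {0<..<t}) p = 0"
      using weak_gradient_smooth_box[OF s, of 0 L 0 \<eta>] assms R by (auto elim!: eventually_mono simp: indicator_def)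
    then have "(\<integral>\<^sup>+p\<in>{a<..<b} \<times> {0<..<t}.
        ennreal ((?u p - ?u p)\<^sup>2 + (norm (gradient ?u p - weak_gradient ?\<Omega> ?u p))\<^sup>2) \<partial>lebesgue) = (\<integral>\<^sup>+p. 0 \<partial>(lebesgue :: (real \<times> real) measure))"
      by (rule nn_integral_cong_AE)
    moreover have "(\<integral>\<^sup>+x\<in>{a<..<b}. ennreal ((?u (x, 0) - x)\<^sup>2) \<partial>lebesgue) = 0"
      by (simp add: decaying_strain_def)
    ultimately show "\<exists>v :: nat \<Rightarrow> real \<times> real \<Rightarrow> real. (\<forall>n. smooth (v n)) \<and>
           (\<lambda>n. \<integral>\<^sup>+p\<in>{a<..<b} \<times> {0<..<t}.
              ennreal ((v n p - ?u p)\<^sup>2 + (norm (gradient (v n) p - weak_gradient ?\<Omega> ?u p))\<^sup>2) \<partial>lebesgue) \<longlonglongrightarrow> 0 \<and>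
           (\<lambda>n. \<integral>\<^sup>+x\<in>{a<..<b}. ennreal ((v n (x, 0) - x)\<^sup>2) \<partial>lebesgue) \<longlonglongrightarrow> 0"
      using s by (intro exI[of _ "\<lambda>n. ?u"]) simp
  qed
  then have trace: "\<exists>T. is_bottom_trace ?\<Omega> ?u T \<and> (AE x in lebesgue. x \<in> closure {x. plateau L \<eta> x \<noteq> 0} \<longrightarrow> T x = x)"
    by (rule_tac x = "\<lambda>x. x" in exI) (rule conjI, assumption, rule AE_I2, rule impI, rule refl)
  have nonneg: "\<forall>x. 0 \<le> plateau L \<eta> x" using assms by (simp add: plateau_def)
  have BV: "plateau L \<eta> \<in> BV" and lsc: "lower_semicontinuous (plateau L \<eta>)"
    using assms by (simp_all add: plateau_in_BV lower_semicontinuous_plateau)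
  show ?thesis
    unfolding admissible_def mem_Collect_eq case_prod_conv subgraph_plateau[OF assms(2)]
    by (intro conjI BV lsc nonneg H1 vol trace)
qed

lemma competitor_energy:
  assumes "0 < L" "0 < \<eta>"
  shows "energy (decaying_strain L) (plateau L \<eta>) \<le> ennreal (min (2 * (L * \<eta>)) (L^2) + 2 * \<eta>)"
proof -
  let ?u = "decaying_strain L" and ?\<Omega> = "box (0,0) (L,\<eta>)"
  have "AE p in lebesgue. ennreal ((norm (weak_gradient ?\<Omega> ?u p))\<^sup>2) * indicator ?\<Omega> p
     = ennreal ((norm (gradient ?u p))\<^sup>2) * indicator ?\<Omega> p"
    using weak_gradient_smooth_box[OF smooth_decaying_strain[of L], of 0 L 0 \<eta>] assms
    by (auto elim!: eventually_mono simp: indicator_def)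
  then have "(\<integral>\<^sup>+p\<in>?\<Omega>. ennreal ((norm (weak_gradient ?\<Omega> ?u p))\<^sup>2) \<partial>lebesgue)
     = (\<integral>\<^sup>+p\<in>?\<Omega>. ennreal ((norm (gradient ?u p))\<^sup>2) \<partial>lebesgue)"
    by (rule nn_integral_cong_AE)
  then have "energy ?u (plateau L \<eta>) \<le> ennreal (min (2 * (L * \<eta>)) (L^2)) + ennreal (2 * \<eta>)"
    unfolding energy_def using decaying_strain_energy[OF assms] pointwise_variation_plateau[of L \<eta>] assms
    by (simp add: subgraph_plateau add_mono)
  then show ?thesis using assms by (subst ennreal_plus) auto
qed

text \<open>For \<open>V \<le> 1\<close> the island has width 1 and height \<open>V\<close>, and both parts of the energy are at most \<open>2 * V\<close>.
  For larger \<open>V\<close> its width is \<open>V powr (1/3)\<close> and its height is the square of that; the elastic part is at most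
  \<open>V powr (2/3)\<close> and the surface part is twice that.\<close>

lemma F_ell_upper_bound:
  assumes "0 < V"
  shows "F_ell V \<le> ennreal (4 * min V (V powr (2/3)))"
proof -
  have F: "F_ell V \<le> ennreal (min (2 * V) (L^2) + 2 * \<eta>)" if "0 < L" "0 < \<eta>" "L * \<eta> = V" for L \<eta>
  proof -
    have "F_ell V \<le> energy (decaying_strain L) (plateau L \<eta>)"
      unfolding F_ell_def
      by (rule INF_lower2[of "(decaying_strain L, plateau L \<eta>)"]) (use competitor_admissible[of L \<eta>] that in auto)
    also have "\<dots> \<le> ennreal (min (2 * V) (L^2) + 2 * \<eta>)"
      using competitor_energy[of L \<eta>] that by simp
    finally show ?thesis .
  qed
  show ?thesis
  proof (cases "V \<le> 1")
    case True
    have "V powr 1 \<le> V powr (2/3)" using True \<open>0 < V\<close> by (intro powr_mono') auto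
    then have m: "min V (V powr (2/3)) = V" using \<open>0 < V\<close> by simp
    have "F_ell V \<le> ennreal (min (2 * V) (1^2) + 2 * V)" using F[of 1 V] \<open>0 < V\<close> by simp
    also have "\<dots> \<le> ennreal (4 * min V (V powr (2/3)))" unfolding m by (intro ennreal_leI) simp
    finally show ?thesis .
  next
    case False
    define L where "L = V powr (1/3)"
    have "0 < L" using \<open>0 < V\<close> by (simp add: L_def)
    have w: "V powr (2/3) = L^2" "V = L^3"
      using \<open>0 < V\<close> by (simp_all add: L_def powr_powr flip: powr_numeral)
    have "V powr (2/3) \<le> V powr 1" using False by (intro powr_mono) auto
    then have m: "min V (V powr (2/3)) = L^2" using \<open>0 < V\<close> w(1) by simp
    have "L * L^2 = V" using w(2) by (simp add: power3_eq_cube power2_eq_square)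
    from F[OF \<open>0 < L\<close> _ this] have "F_ell V \<le> ennreal (min (2 * V) (L^2) + 2 * L^2)" using \<open>0 < L\<close> by simp
    also have "\<dots> \<le> ennreal (4 * min V (V powr (2/3)))" unfolding m by (intro ennreal_leI) (simp add: min_le_iff_disj)
    finally show ?thesis .
  qed
qed

section \<open>The scaling law\<close>

theorem proposition4p3:
  shows "\<exists>c0::real. c0 > 0 \<and>
    (\<forall>V::real. V > 0 \<longrightarrow>
       ennreal (c0 * min V (V powr (2/3))) \<le> F_ell V \<and>
       F_ell V \<le> ennreal (1 / c0 * min V (V powr (2/3)))) \<and>
    (\<exists>c::real. c > 0 \<and>
       (\<exists>V0::real. V0 > 0 \<and>
         (\<forall>V::real. V \<ge> V0 \<longrightarrow>
           (\<forall>(u, h) \<in> admissible V.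
              energy u h \<le> ennreal (1 / c0 * min V (V powr (2/3))) \<longrightarrow>
              (SUP x. ennreal (h x)) \<ge> ennreal (c * V powr (2/3))))))"
proof -
  define c where "c = (1 / (8 * 576 * 1153 * 2306) :: real)"
  define V0 where "V0 = ((8 * 576 * 1153) ^ 3 :: real)"
  have pos: "0 < c" "0 < V0" by (simp_all add: c_def V0_def)
  have "F_ell V \<le> ennreal (1 / (1 / 1153) * min V (V powr (2/3)))" if "0 < V" for V
  proof -
    have "F_ell V \<le> ennreal (4 * min V (V powr (2/3)))"
      by (rule F_ell_upper_bound[OF that])
    also have "\<dots> \<le> ennreal (1 / (1 / 1153) * min V (V powr (2/3)))"
      using that by (intro ennreal_leI mult_right_mono) auto
    finally show ?thesis .
  qed
  then have bounds: "\<forall>V::real. V > 0 \<longrightarrow>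
       ennreal (1 / 1153 * min V (V powr (2/3))) \<le> F_ell V \<and>
       F_ell V \<le> ennreal (1 / (1 / 1153) * min V (V powr (2/3)))"
    using F_ell_lower_bound by blast
  have "ennreal (c * V powr (2/3)) \<le> (SUP x. ennreal (h x))"
    if "V0 \<le> V" "(u, h) \<in> admissible V"
      "energy u h \<le> ennreal (1 / (1 / 1153) * min V (V powr (2/3)))" for V u h
    using sup_lower_bound[of u h V] that by (simp add: c_def V0_def)
  then have "\<forall>V::real. V \<ge> V0 \<longrightarrow>
           (\<forall>(u, h) \<in> admissible V.
              energy u h \<le> ennreal (1 / (1 / 1153) * min V (V powr (2/3))) \<longrightarrow>
              (SUP x. ennreal (h x)) \<ge> ennreal (c * V powr (2/3)))"
    by blast
  then have height: "\<exists>c::real. c > 0 \<and>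
       (\<exists>V0::real. V0 > 0 \<and>
         (\<forall>V::real. V \<ge> V0 \<longrightarrow>
           (\<forall>(u, h) \<in> admissible V.
              energy u h \<le> ennreal (1 / (1 / 1153) * min V (V powr (2/3))) \<longrightarrow>
              (SUP x. ennreal (h x)) \<ge> ennreal (c * V powr (2/3)))))"
    using pos by blast
  show ?thesis
    by (rule exI[of _ "1 / 1153"], intro conjI bounds height) simp
qed

end
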